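(* Let $U$ and $V$ consist of $n$ i.i.d. random points each, sampled independently from probability measures $\mu$ (supply) and $\nu$ (demand) on the network $\mathcal L$, and let $Z^{\mathrm{CF}}$ be the optimal value of $$\min_{\mathbf c\in\mathbb Z^{|\mathcal E|}}\ \sum_{e\in\mathcal E}\Psi_e(c_e;S_e)\quad\text{s.t.}\quad\mathbf I\mathbf c=\mathbf I^+\mathbf s,$$ which equals the minimum total matching distance between $U$ and $V$. Then, as $n\to\infty$, $$\mathbb E[Z^{\mathrm{CF}}]\asymp\begin{cases}\sqrt n,&\text{if }\mu=\nu,\\ n,&\text{if }\mu\ne\nu,\end{cases}$$ where $a_n\asymp b_n$ means that $a_n/b_n$ is bounded above and below by positive constants for all large $n$.
   Context: $(\mathcal V,\mathcal E)$ is an undirected network. Each edge $e\in\mathcal E$ has length $l_e\ge 0$ and end nodes $v_e^-,v_e^+\in\mathcal V$ (an arbitrary orientation from $v_e^-$ to $v_e^+$ is fixed). A location on $e$ is recorded as $(e,x)$, $x\in[0,l_e]$, where $x$ is the distance from $v_e^-$ along $e$. Put $\mathcal L_e(x)=\{(e,y):y\in[0,x]\}$ and $\mathcal L=\bigcup_{e}\mathcal L_e(l_e)$. $\mu,\nu$ are probability measures on a $\sigma$-algebra $\mathcal F$ on $\mathcal L$; for $A\in\mathcal F$, $\mu(A)$ (resp. $\nu(A)$) is the probability that a random supply (resp. demand) point lies in $A$. The network and $\mu,\nu$ are fixed as $n\to\infty$. The imbalance profile of edge $e$ is $S_e(x)=|U\cap\mathcal L_e(x)|-|V\cap\mathcal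 L_e(x)|$ for $x\in[0,l_e]$, and $\mathbf s=(S_e(l_e))_{e\in\mathcal E}$. For a profile $\xi_e:[0,l_e]\to\mathbb R$ and $c\in\mathbb R$, $\Psi_e(c;\xi_e)=\int_0^{l_e}|\xi_e(x)-c|\,dx$. $\mathbf I^+$ (resp. $\mathbf I^-$) is the $\mathcal V\times\mathcal E$ matrix whose $(v,e)$ entry is $1$ if $v_e^+=v$ (resp. $v_e^-=v$) and $0$ otherwise; $\mathbf I=\mathbf I^+-\mathbf I^-$.
   Formalization: The network is finite and connected; μ=ν means equality as measures on points of the network (all edge records of a node are one point); the √n claim assumes μ is not concentrated at a single point, since otherwise Z^CF=0. *)

theory Defs
  imports "HOL-Probability.Probability" "HOL-Library.Landau_Symbols"
begin

section \<open>Networks and locations\<close>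

text \<open>Parallel edges, loops and edges of length zero are allowed.\<close>

record ('v, 'e) network =
  nodes :: "'v set"
  edges :: "'e set"
  len :: "'e \<Rightarrow> real"
  tail :: "'e \<Rightarrow> 'v"
  head :: "'e \<Rightarrow> 'v"

text \<open>
  Connectedness makes the matching distance finite and the integer program feasible for
  arbitrary supply and demand sets of equal size.
\<close>

definition connected_network :: "('v, 'e) network \<Rightarrow> bool" where
  "connected_network N \<longleftrightarrow>
     finite (nodes N) \<and> finite (edges N) \<and>
     (\<forall>e\<in>edges N. 0 \<le> len N e \<and> tail N e \<in> nodes N \<and> head N e \<in> nodes N) \<and>
     (\<forall>a\<in>nodes N. \<forall>b\<in>nodes N.
        (a, b) \<in> ({(tail N e, head N e) | e. e \<in> edges N} \<union>
                 {(head N e, tail N e) | e. e \<in> edges N})\<^sup>*)"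

definition segment :: "'e \<Rightarrow> real \<Rightarrow> ('e \<times> real) set" where
  "segment e x = {(e, y) | y. 0 \<le> y \<and> y \<le> x}"

definition locations :: "('v, 'e) network \<Rightarrow> ('e \<times> real) set" where
  "locations N = (\<Union>e\<in>edges N. segment e (len N e))"

text \<open>
  The smallest sigma-algebra for which all the counts defining an imbalance profile are
  measurable, i.e. the Borel sets of the disjoint union of the edges.
\<close>

definition location_algebra :: "('v, 'e) network \<Rightarrow> ('e \<times> real) measure" where
  "location_algebra N =
     sigma (locations N) {segment e x | e x. e \<in> edges N \<and> 0 \<le> x \<and> x \<le> len N e}"


section \<open>The network distance\<close>

text \<open>
  A node has one record \<open>(e, x)\<close> for each incident edge end. Both ends of an edge of length
  zero have the same record.
\<close>

definition located_at :: "('v, 'e) network \<Rightarrow> 'e \<times> real \<Rightarrow> 'v \<Rightarrow> bool" where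
  "located_at N p a \<longleftrightarrow> fst p \<in> edges N \<and>
     (snd p = 0 \<and> tail N (fst p) = a \<or> snd p = len N (fst p) \<and> head N (fst p) = a)"

text \<open>\<open>travel N p q r\<close>: there is a route of length \<open>r\<close> from \<open>p\<close> to \<open>q\<close>. Routes move along
  edges, and pass at no cost between the records of a node.\<close>

inductive travel :: "('v, 'e) network \<Rightarrow> 'e \<times> real \<Rightarrow> 'e \<times> real \<Rightarrow> real \<Rightarrow> bool"
  for N :: "('v, 'e) network" and p :: "'e \<times> real" where
  stay: "p \<in> locations N \<Longrightarrow> travel N p p 0"
| move: "travel N p (e, x) r \<Longrightarrow> (e, y) \<in> locations N \<Longrightarrow> travel N p (e, y) (r + \<bar>x - y\<bar>)"
| switch: "travel N p q r \<Longrightarrow> located_at N q a \<Longrightarrow> located_at N q' a \<Longrightarrow> travel N p q' r"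

definition net_dist :: "('v, 'e) network \<Rightarrow> 'e \<times> real \<Rightarrow> 'e \<times> real \<Rightarrow> real" where
  "net_dist N p q = Inf {r. travel N p q r}"

text \<open>The point of the network recorded by \<open>p\<close>, as the set of all its records.\<close>

definition net_point :: "('v, 'e) network \<Rightarrow> 'e \<times> real \<Rightarrow> ('e \<times> real) set" where
  "net_point N p = {q \<in> locations N. net_dist N p q = 0}"

text \<open>
  Equality of two distributions as measures on the network, i.e. on sets of points: moving
  mass between different records of the same point does not change the distribution.
\<close>

definition same_distribution ::
  "('v, 'e) network \<Rightarrow> ('e \<times> real) measure \<Rightarrow> ('e \<times> real) measure \<Rightarrow> bool" where
  "same_distribution N \<mu> \<nu> \<longleftrightarrow>
     (\<forall>A \<in> sets (location_algebra N).
        (\<forall>p\<in>A. net_point N p \<subseteq> A) \<longrightarrow> measure \<mu> A = measure \<nu> A)"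


section \<open>Minimum matching distance and the integer program\<close>

text \<open>
  The point sets are given as families \<open>u\<close>, \<open>v\<close> indexed by \<open>{..<n}\<close>, so that coinciding
  sample points are counted with multiplicity.
\<close>

definition min_matching_dist ::
  "('v, 'e) network \<Rightarrow> nat \<Rightarrow> (nat \<Rightarrow> 'e \<times> real) \<Rightarrow> (nat \<Rightarrow> 'e \<times> real) \<Rightarrow> real" where
  "min_matching_dist N n u v =
     Min ((\<lambda>\<sigma>. \<Sum>i<n. net_dist N (u i) (v (\<sigma> i))) ` {\<sigma>. \<sigma> permutes {..<n}})"

definition imbalance ::
  "nat \<Rightarrow> (nat \<Rightarrow> 'e \<times> real) \<Rightarrow> (nat \<Rightarrow> 'e \<times> real) \<Rightarrow> 'e \<Rightarrow> real \<Rightarrow> int" where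
  "imbalance n u v e x =
     int (card {i. i < n \<and> u i \<in> segment e x}) - int (card {i. i < n \<and> v i \<in> segment e x})"

definition Psi :: "('v, 'e) network \<Rightarrow> 'e \<Rightarrow> real \<Rightarrow> (real \<Rightarrow> real) \<Rightarrow> real" where
  "Psi N e c \<xi> = (LBINT x:{0..len N e}. \<bar>\<xi> x - c\<bar>)"

definition inc_plus :: "('v, 'e) network \<Rightarrow> 'v \<Rightarrow> 'e \<Rightarrow> int" where
  "inc_plus N a e = (if head N e = a then 1 else 0)"

definition inc_minus :: "('v, 'e) network \<Rightarrow> 'v \<Rightarrow> 'e \<Rightarrow> int" where
  "inc_minus N a e = (if tail N e = a then 1 else 0)"

definition inc :: "('v, 'e) network \<Rightarrow> 'v \<Rightarrow> 'e \<Rightarrow> int" where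
  "inc N a e = inc_plus N a e - inc_minus N a e"

definition cf_feasible ::
  "('v, 'e) network \<Rightarrow> nat \<Rightarrow> (nat \<Rightarrow> 'e \<times> real) \<Rightarrow> (nat \<Rightarrow> 'e \<times> real) \<Rightarrow> ('e \<Rightarrow> int) \<Rightarrow> bool" where
  "cf_feasible N n u v c \<longleftrightarrow>
     (\<forall>a\<in>nodes N. (\<Sum>e\<in>edges N. inc N a e * c e) =
                  (\<Sum>e\<in>edges N. inc_plus N a e * imbalance n u v e (len N e)))"

definition cf_cost ::
  "('v, 'e) network \<Rightarrow> nat \<Rightarrow> (nat \<Rightarrow> 'e \<times> real) \<Rightarrow> (nat \<Rightarrow> 'e \<times> real) \<Rightarrow> ('e \<Rightarrow> int) \<Rightarrow> real" where
  "cf_cost N n u v c =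
     (\<Sum>e\<in>edges N. Psi N e (real_of_int (c e)) (\<lambda>x. real_of_int (imbalance n u v e x)))"

definition Z_CF ::
  "('v, 'e) network \<Rightarrow> nat \<Rightarrow> (nat \<Rightarrow> 'e \<times> real) \<Rightarrow> (nat \<Rightarrow> 'e \<times> real) \<Rightarrow> real" where
  "Z_CF N n u v = (INF c\<in>{c. cf_feasible N n u v c}. cf_cost N n u v c)"

definition expected_Z_CF ::
  "('v, 'e) network \<Rightarrow> ('e \<times> real) measure \<Rightarrow> ('e \<times> real) measure \<Rightarrow> nat \<Rightarrow> real" where
  "expected_Z_CF N \<mu> \<nu> n =
     (\<integral>\<omega>. Z_CF N n (fst \<omega>) (snd \<omega>)
        \<partial>((\<Pi>\<^sub>M i\<in>{..<n}. \<mu>) \<Otimes>\<^sub>M (\<Pi>\<^sub>M i\<in>{..<n}. \<nu>)))"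

end

theory Submission
  imports Defs "HOL-Combinatorics.Cycles"
begin

text \<open>
  Optimality of a matching means that no cyclic exchange of partners shortens it, which yields a
  potential \<open>\<phi>\<close>, Lipschitz for the network distance, with
  \<open>\<Sum>i. \<phi> (u i) - \<phi> (v i)\<close> equal to the matching distance. Integration by parts along every edge
  bounds this sum by the cost of any \<open>c\<close>, the flow constraint cancelling the boundary terms;
  conversely, the routes of a matching are superposed to a feasible \<open>c\<close> of no larger cost.

  Potentials also control the expectation. If \<open>\<mu>\<close> and \<open>\<nu>\<close> differ, some Lipschitz function has
  different means and gives a linear lower bound. If they agree, a potential normalised to be
  bounded by the diameter bounds the matching distance by the absolute imbalances, whose
  expectations are of order \<open>sqrt n\<close>. For the lower bound take \<open>\<phi> = d(\<cdot>, q)\<close> with \<open>q\<close> in the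
  support of \<open>\<mu>\<close>: it is not almost surely constant, and the characteristic function of
  \<open>\<Sum>i. \<phi> (u i)\<close> at arguments of order \<open>1 / sqrt n\<close> shows that this sum has spread \<open>sqrt n\<close>
  around every constant, in particular around \<open>\<Sum>i. \<phi> (v i)\<close>.
\<close>

text \<open>A location is a record, and a node may have several records at mutual distance 0.
  Distances and Lipschitz functions cannot tell these apart, while segments can. Hence distributions
  are compared on sets that contain all records of each of their points, and the square-root upper
  bound passes to representatives before counting.

  Distances are infima over routes, so primal constructions work up to an arbitrary
  \<open>\<epsilon>\<close>. Integrality costs nothing: the dual bound holds for real
  \<open>c\<close>, and the \<open>c\<close> built from routes has integer entries.

  If all mass of both measures sits on one network point, every matching costs 0. The square-root
  lower bound therefore needs a nondegeneracy condition, which enters as a positive variance of the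
  distance to a support point. A variance bounds the mean absolute deviation only from above, which
  is why characteristic functions are used from below; a shift of the sum changes them by a factor
  of modulus 1, so the bound is uniform in the centre and survives conditioning on the demand
  points.\<close>

lemma mem_segment: "p \<in> segment e x \<longleftrightarrow> fst p = e \<and> 0 \<le> snd p \<and> snd p \<le> x"
  by (cases p) (auto simp: segment_def)

lemma mem_locations:
  "p \<in> locations N \<longleftrightarrow> fst p \<in> edges N \<and> 0 \<le> snd p \<and> snd p \<le> len N (fst p)"
  by (auto simp: locations_def mem_segment)

locale connected_net =
  fixes N :: "('v, 'e) network"
  assumes connected: "connected_network N"
begin

lemma finite_nodes: "finite (nodes N)"
  and finite_edges: "finite (edges N)"
  and len_nonneg: "e \<in> edges N \<Longrightarrow> 0 \<le> len N e"
  and tail_in_nodes: "e \<in> edges N \<Longrightarrow> tail N e \<in> nodes N"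
  and head_in_nodes: "e \<in> edges N \<Longrightarrow> head N e \<in> nodes N"
  and nodes_joined: "a \<in> nodes N \<Longrightarrow> b \<in> nodes N \<Longrightarrow>
    (a, b) \<in> ({(tail N e, head N e) | e. e \<in> edges N} \<union>
                 {(head N e, tail N e) | e. e \<in> edges N})\<^sup>*"
  using connected by (simp_all add: connected_network_def)

section \<open>Routes\<close>

lemma located_at_locations: "located_at N q a \<Longrightarrow> q \<in> locations N"
  using len_nonneg by (auto simp: located_at_def mem_locations)

lemma located_at_tail: "e \<in> edges N \<Longrightarrow> located_at N (e, 0) (tail N e)"
  and located_at_head: "e \<in> edges N \<Longrightarrow> located_at N (e, len N e) (head N e)"
  by (auto simp: located_at_def)

lemma start_in_locations: "e \<in> edges N \<Longrightarrow> (e, 0) \<in> locations N"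
  and end_in_locations: "e \<in> edges N \<Longrightarrow> (e, len N e) \<in> locations N"
  using len_nonneg by (auto simp: mem_locations)

lemma travel_nonneg: "travel N p q r \<Longrightarrow> 0 \<le> r"
  by (induction rule: travel.induct) auto

lemma travel_locations:
  assumes "travel N p q r" shows "p \<in> locations N" "q \<in> locations N"
proof -
  have "p \<in> locations N \<and> q \<in> locations N"
    using assms by (induction rule: travel.induct) (auto dest: located_at_locations)
  then show "p \<in> locations N" "q \<in> locations N" by auto
qed

lemma travel_trans:
  assumes "travel N p q r" "travel N q s t"
  shows "travel N p s (r + t)"
  using assms(2,1)
proof (induction rule: travel.induct)
  case (move e x t y)
  then show ?case using travel.move[of N p e x "r + t" y] by (simp add: add.assoc)
qed (auto intro: travel.switch)

lemma travel_edge: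
  assumes "(e, x) \<in> locations N" "(e, y) \<in> locations N"
  shows "travel N (e, x) (e, y) \<bar>x - y\<bar>"
  using travel.move[OF travel.stay[OF assms(1)] assms(2)] by simp

lemma travel_node:
  assumes "located_at N p a" "located_at N q a"
  shows "travel N p q 0"
  using travel.switch[OF travel.stay assms] located_at_locations[OF assms(1)] by simp

lemma travel_sym:
  assumes "travel N p q r" shows "travel N q p r"
  using assms
proof (induction rule: travel.induct)
  case stay
  then show ?case by (rule travel.stay)
next
  case (move e x r y)
  then show ?case
    using travel_trans[OF travel_edge[of e y x] move.IH] travel_locations[OF move.hyps(1)]
    by (simp add: abs_minus_commute add.commute)
next
  case (switch q r a q')
  then show ?case using travel_trans[OF travel_node[of q' a q]] by fastforce
qed

text \<open>Connectedness of the node graph lifts to records: walk from \<open>p\<close> to the tail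
  of its edge, follow a chain of nodes while keeping some record of the current node, and enter the
  edge of \<open>q\<close> from its tail.\<close>

lemma travel_exists:
  assumes "p \<in> locations N" "q \<in> locations N"
  shows "\<exists>r. travel N p q r"
proof -
  obtain e x f y where p: "p = (e, x)" and q: "q = (f, y)" by (cases p, cases q)
  have e: "e \<in> edges N" and f: "f \<in> edges N" using assms by (auto simp: p q mem_locations)
  have "\<exists>s r. travel N p s r \<and> located_at N s b"
    if "(tail N e, b) \<in> ({(tail N e, head N e) | e. e \<in> edges N} \<union>
                 {(head N e, tail N e) | e. e \<in> edges N})\<^sup>*" for b
    using that
  proof (induction rule: rtrancl_induct)
    case base
    show ?case
      using travel_edge[of e x 0] assms(1) start_in_locations[OF e] located_at_tail[OF e]
      unfolding p by blast
  next
    case (step b c)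
    then obtain s r where s: "travel N p s r" "located_at N s b" by blast
    from step.hyps(2) obtain g where g: "g \<in> edges N"
      and "b = tail N g \<and> c = head N g \<or> b = head N g \<and> c = tail N g" by auto
    then show ?case
    proof (elim disjE conjE)
      assume [simp]: "b = tail N g" "c = head N g"
      have "travel N p (g, len N g) (r + \<bar>0 - len N g\<bar>)"
        by (rule travel.move[OF travel.switch[OF s]])
          (use g located_at_tail end_in_locations in auto)
      then show ?thesis using located_at_head[OF g] by auto
    next
      assume [simp]: "b = head N g" "c = tail N g"
      have "travel N p (g, 0) (r + \<bar>len N g - 0\<bar>)"
        by (rule travel.move[OF travel.switch[OF s]])
          (use g located_at_head start_in_locations in auto)
      then show ?thesis using located_at_tail[OF g] by auto
    qed
  qed
  from this[OF nodes_joined[OF tail_in_nodes[OF e] tail_in_nodes[OF f]]]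
  obtain s r where "travel N p s r" "located_at N s (tail N f)" by blast
  then have "travel N p (f, 0) r" using located_at_tail[OF f] by (rule travel.switch)
  then show ?thesis using travel.move[of N p f 0 r y] assms(2) unfolding q by blast
qed

section \<open>The network distance is a pseudometric\<close>

lemma bdd_below_travel: "bdd_below {r. travel N p q r}"
  by (meson bdd_belowI mem_Collect_eq travel_nonneg)

lemma net_dist_le: "travel N p q r \<Longrightarrow> net_dist N p q \<le> r"
  unfolding net_dist_def by (rule cInf_lower) (auto simp: bdd_below_travel)

lemma le_net_dist:
  assumes "p \<in> locations N" "q \<in> locations N" "\<And>r. travel N p q r \<Longrightarrow> z \<le> r"
  shows "z \<le> net_dist N p q"
  unfolding net_dist_def using travel_exists[OF assms(1,2)] assms(3)
  by (intro cInf_greatest) auto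

text \<open>The distance is an infimum and no shortest route is constructed; arguments that need an
  actual route take one exceeding the distance by less than \<open>\<epsilon>\<close>.\<close>

lemma net_dist_approx:
  assumes "p \<in> locations N" "q \<in> locations N" "0 < \<epsilon>"
  obtains r where "travel N p q r" "r < net_dist N p q + \<epsilon>"
proof -
  have "\<exists>r\<in>{r. travel N p q r}. r < net_dist N p q + \<epsilon>"
    using travel_exists[OF assms(1,2)] assms(3) unfolding net_dist_def
    by (subst cInf_less_iff[symmetric]) (auto simp: bdd_below_travel)
  then show thesis using that by blast
qed

lemma net_dist_nonneg:
  assumes "p \<in> locations N" "q \<in> locations N" shows "0 \<le> net_dist N p q"
  using le_net_dist[OF assms] travel_nonneg by blast

lemma net_dist_refl: "p \<in> locations N \<Longrightarrow> net_dist N p p = 0"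
  using net_dist_le[OF travel.stay] net_dist_nonneg by (meson order_antisym)

lemma net_dist_sym: "net_dist N p q = net_dist N q p"
proof -
  have "travel N p q = travel N q p" using travel_sym by blast
  then show ?thesis by (simp add: net_dist_def)
qed

lemma net_dist_triangle:
  assumes "p \<in> locations N" "q \<in> locations N" "s \<in> locations N"
  shows "net_dist N p s \<le> net_dist N p q + net_dist N q s"
proof (rule field_le_epsilon)
  fix \<epsilon> :: real assume "0 < \<epsilon>"
  then have "0 < \<epsilon> / 2" by simp
  obtain r where r: "travel N p q r" "r < net_dist N p q + \<epsilon> / 2"
    using net_dist_approx[OF assms(1,2) \<open>0 < \<epsilon> / 2\<close>] .
  obtain t where t: "travel N q s t" "t < net_dist N q s + \<epsilon> / 2"
    using net_dist_approx[OF assms(2,3) \<open>0 < \<epsilon> / 2\<close>] .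
  show "net_dist N p s \<le> net_dist N p q + net_dist N q s + \<epsilon>"
    using net_dist_le[OF travel_trans[OF r(1) t(1)]] r(2) t(2) by simp
qed

lemma net_dist_edge:
  "(e, x) \<in> locations N \<Longrightarrow> (e, y) \<in> locations N \<Longrightarrow> net_dist N (e, x) (e, y) \<le> \<bar>x - y\<bar>"
  by (intro net_dist_le travel_edge)

lemma net_dist_node:
  assumes "located_at N p a" "located_at N q a"
  shows "net_dist N p q = 0"
  using net_dist_le[OF travel_node[OF assms]] net_dist_nonneg assms
  by (meson located_at_locations order_antisym)

lemma net_dist_bounded:
  obtains D where "0 \<le> D" "\<And>p q. p \<in> locations N \<Longrightarrow> q \<in> locations N \<Longrightarrow> net_dist N p q \<le> D"
proof
  define d where "d e f = net_dist N (e, 0) (f, 0)" for e f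
  \<comment> \<open>Three legs: from \<open>p\<close> to the start of its edge, on to the start of
    the edge of \<open>q\<close>, then to \<open>q\<close>. Each leg is bounded by a sum over all
    edges, which makes sense for an empty edge set too.\<close>
  define D where "D = (\<Sum>e\<in>edges N. len N e) + (\<Sum>e\<in>edges N. \<Sum>f\<in>edges N. d e f)
     + (\<Sum>e\<in>edges N. len N e)"
  have d: "0 \<le> d e f" if "e \<in> edges N" "f \<in> edges N" for e f
    unfolding d_def using that by (intro net_dist_nonneg start_in_locations)
  show "0 \<le> D" unfolding D_def by (intro add_nonneg_nonneg sum_nonneg len_nonneg d)
  fix p q assume pq: "p \<in> locations N" "q \<in> locations N"
  obtain e x f y where p: "p = (e, x)" and q: "q = (f, y)" by (cases p, cases q)
  have e: "e \<in> edges N" "0 \<le> x" "x \<le> len N e" and f: "f \<in> edges N" "0 \<le> y" "y \<le> len N f"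
    using pq by (auto simp: p q mem_locations)
  have le: "len N e \<le> (\<Sum>e\<in>edges N. len N e)" if "e \<in> edges N" for e
    using that finite_edges len_nonneg by (intro member_le_sum) auto
  have "d e f \<le> (\<Sum>f\<in>edges N. d e f)"
    using finite_edges e(1) f(1) by (intro member_le_sum) (auto intro: d)
  also have "\<dots> \<le> (\<Sum>e\<in>edges N. \<Sum>f\<in>edges N. d e f)"
    using finite_edges e(1) d
    by (intro member_le_sum[where f = "\<lambda>e. \<Sum>f\<in>edges N. d e f"]) (auto intro!: sum_nonneg)
  finally have "d e f \<le> (\<Sum>e\<in>edges N. \<Sum>f\<in>edges N. d e f)" .
  moreover have "net_dist N p q \<le> net_dist N p (e, 0) + (d e f + net_dist N (f, 0) q)"
    using net_dist_triangle[OF pq(1) start_in_locations pq(2), OF e(1)]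
      net_dist_triangle[OF start_in_locations start_in_locations pq(2), OF e(1) f(1)]
    unfolding d_def by linarith
  moreover have "net_dist N p (e, 0) \<le> len N e" "net_dist N (f, 0) q \<le> len N f"
    using net_dist_edge[of e x 0] net_dist_edge[of f 0 y] pq start_in_locations[OF e(1)]
      start_in_locations[OF f(1)] e f unfolding p q by auto
  ultimately show "net_dist N p q \<le> D"
    using le[OF e(1)] le[OF f(1)] unfolding D_def by linarith
qed

section \<open>Lipschitz functions on the network\<close>

definition net_lipschitz :: "real \<Rightarrow> ('e \<times> real \<Rightarrow> real) \<Rightarrow> bool" where
  "net_lipschitz L \<phi> \<longleftrightarrow>
     (\<forall>p\<in>locations N. \<forall>q\<in>locations N. \<phi> p - \<phi> q \<le> L * net_dist N p q)"

lemma net_lipschitzD: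
  "net_lipschitz L \<phi> \<Longrightarrow> p \<in> locations N \<Longrightarrow> q \<in> locations N \<Longrightarrow> \<phi> p - \<phi> q \<le> L * net_dist N p q"
  unfolding net_lipschitz_def by blast

lemma net_lipschitz_abs:
  "net_lipschitz L \<phi> \<Longrightarrow> p \<in> locations N \<Longrightarrow> q \<in> locations N \<Longrightarrow>
    \<bar>\<phi> p - \<phi> q\<bar> \<le> L * net_dist N p q"
  using net_lipschitzD[of L \<phi> p q] net_lipschitzD[of L \<phi> q p] net_dist_sym[of p q] by auto

text \<open>A local criterion, by induction on routes: a move changes \<open>\<phi>\<close> by at
  most \<open>L\<close> times its length, a switch not at all. Passing to the infimum divides by
  \<open>L\<close>, hence the separate case \<open>L = 0\<close>.\<close>

lemma net_lipschitzI:
  assumes L: "0 \<le> L"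
    and edge: "\<And>e x y. (e, x) \<in> locations N \<Longrightarrow> (e, y) \<in> locations N \<Longrightarrow>
      \<bar>\<phi> (e, x) - \<phi> (e, y)\<bar> \<le> L * \<bar>x - y\<bar>"
    and node: "\<And>p q a. located_at N p a \<Longrightarrow> located_at N q a \<Longrightarrow> \<phi> p = \<phi> q"
  shows "net_lipschitz L \<phi>"
  unfolding net_lipschitz_def
proof (intro ballI)
  fix p q assume pq: "p \<in> locations N" "q \<in> locations N"
  have route: "\<phi> p - \<phi> q \<le> L * r" if "travel N p q r" for q r
    using that
  proof (induction rule: travel.induct)
    case (move e x r y)
    then show ?case
      using edge[of e x y] travel_locations(2)[OF move.hyps(1)] by (auto simp: distrib_left)
  next
    case (switch q r a q')
    then show ?case using node[of q a q'] by simp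
  qed simp
  show "\<phi> p - \<phi> q \<le> L * net_dist N p q"
  proof (cases "L = 0")
    case True
    then show ?thesis using travel_exists[OF pq] route by fastforce
  next
    case False
    then have "(\<phi> p - \<phi> q) / L \<le> net_dist N p q"
      using L route by (intro le_net_dist[OF pq]) (auto simp: field_simps)
    then show ?thesis using L False by (simp add: field_simps)
  qed
qed

lemma net_lipschitz_net_dist:
  assumes "q \<in> locations N" shows "net_lipschitz 1 (\<lambda>p. net_dist N p q)"
  unfolding net_lipschitz_def using net_dist_triangle assms by fastforce

end

section \<open>Potentials of an optimal matching\<close>

fun walk_weight :: "('a \<Rightarrow> 'a \<Rightarrow> real) \<Rightarrow> 'a list \<Rightarrow> real" where
  "walk_weight g (x # y # zs) = g x y + walk_weight g (y # zs)"
| "walk_weight g _ = 0"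

lemma walk_weight_append:
  "walk_weight g (xs @ x # zs) = walk_weight g (xs @ [x]) + walk_weight g (x # zs)"
proof (induction xs)
  case (Cons y xs)
  then show ?case by (cases xs) auto
qed simp

lemma walk_weight_cycle:
  "walk_weight g (x # xs @ [y]) = sum_list (map2 g (x # xs) (xs @ [y]))"
  by (induction xs arbitrary: x) auto

text \<open>A cycle on distinct vertices, extended by the identity, is a permutation of
  \<open>A\<close>; its fixed points contribute nothing because \<open>g\<close> vanishes on the
  diagonal.\<close>

lemma cycle_weight_nonneg:
  assumes perm: "\<And>\<pi>. \<pi> permutes A \<Longrightarrow> 0 \<le> (\<Sum>i\<in>A. g i (\<pi> i))"
    and diag: "\<And>i. i \<in> A \<Longrightarrow> g i i = (0::real)"
    and A: "finite A" and cs: "distinct cs" "set cs \<subseteq> A"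
  shows "0 \<le> sum_list (map2 g cs (rotate1 cs))"
proof -
  define \<pi> where "\<pi> = cycle_of_list cs"
  have \<pi>: "\<pi> permutes set cs" unfolding \<pi>_def by (rule cycle_permutes)
  have rot: "map \<pi> cs = rotate1 cs"
    using cyclic_rotation[OF cs(1), of 1] unfolding \<pi>_def by simp
  have "map2 g cs (rotate1 cs) = map (\<lambda>i. g i (\<pi> i)) cs"
    unfolding rot[symmetric] by (induction cs) auto
  then have "sum_list (map2 g cs (rotate1 cs)) = (\<Sum>i\<in>set cs. g i (\<pi> i))"
    using cs(1) by (simp add: sum_list_distinct_conv_sum_set)
  also have "\<dots> = (\<Sum>i\<in>A. g i (\<pi> i))"
    using A cs(2) diag permutes_not_in[OF \<pi>] by (intro sum.mono_neutral_left) auto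
  finally show ?thesis using perm[OF permutes_subset[OF \<pi> cs(2)]] by simp
qed

text \<open>The potential of \<open>i\<close> is the least weight of a path that starts at \<open>i\<close>.\<close>

lemma potential_exists:
  assumes perm: "\<And>\<pi>. \<pi> permutes A \<Longrightarrow> 0 \<le> (\<Sum>i\<in>A. g i (\<pi> i))"
    and diag: "\<And>i. i \<in> A \<Longrightarrow> g i i = (0::real)"
    and A: "finite A"
  obtains w where "\<And>i j. i \<in> A \<Longrightarrow> j \<in> A \<Longrightarrow> w i \<le> w j + g i j"
proof
  define P where "P i = {xs. distinct (i # xs) \<and> set xs \<subseteq> A}" for i
  define w where "w i = Min ((\<lambda>xs. walk_weight g (i # xs)) ` P i)" for i
  have fin: "finite (P i)" for i
    using finite_subset[OF _ finite_subset_distinct[OF A], of "P i"] unfolding P_def by auto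
  have ne: "[] \<in> P i" for i unfolding P_def by auto
  have w_le: "w i \<le> walk_weight g (i # xs)" if "xs \<in> P i" for i xs
    unfolding w_def using fin that by (intro Min_le) auto
  fix i j assume i: "i \<in> A" and j: "j \<in> A"
  have "w j \<in> (\<lambda>xs. walk_weight g (j # xs)) ` P j"
    unfolding w_def using fin ne[of j] by (intro Min_in) auto
  then obtain xs where xs: "xs \<in> P j" "w j = walk_weight g (j # xs)" by auto
  show "w i \<le> w j + g i j"
  proof (cases "i \<in> set (j # xs)")
    case False
    then have "j # xs \<in> P i" using xs(1) j by (auto simp: P_def)
    then show ?thesis using w_le[of "j # xs" i] xs(2) by simp
  next
    \<comment> \<open>Prepending \<open>i\<close> to the optimal path of \<open>j\<close> closes a
      cycle at the occurrence of \<open>i\<close>. Cutting off this cycle, whose weight is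
      nonnegative, leaves the simple path \<open>i # zs\<close>.\<close>
    case True
    then obtain ys zs where split: "j # xs = ys @ i # zs" by (meson split_list)
    have dist: "distinct (ys @ i # zs)" and sub: "set (ys @ i # zs) \<subseteq> A"
      using xs(1) j unfolding split[symmetric] by (auto simp: P_def)
    have "zs \<in> P i" using dist sub by (auto simp: P_def)
    moreover have "0 \<le> g i j + walk_weight g (ys @ [i])"
    proof (cases ys)
      case Nil
      then show ?thesis using split diag[OF i] by simp
    next
      case (Cons k ys')
      then have "k = j" using split by simp
      have "0 \<le> sum_list (map2 g (i # ys) (rotate1 (i # ys)))"
        using dist sub by (intro cycle_weight_nonneg[where A = A and g = g, OF perm diag A]) auto
      then show ?thesis
        using walk_weight_cycle[of g i ys i] Cons \<open>k = j\<close> by simp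
    qed
    ultimately show ?thesis
      using w_le[of zs i] xs(2) walk_weight_append[of g ys i zs] split by simp
  qed
qed

section \<open>Duality between matchings and Lipschitz potentials\<close>

context connected_net
begin

lemma min_matching_le:
  "\<sigma> permutes {..<n} \<Longrightarrow> min_matching_dist N n u v \<le> (\<Sum>i<n. net_dist N (u i) (v (\<sigma> i)))"
  unfolding min_matching_dist_def by (rule Min_le) (auto simp: finite_permutations)

lemma min_matching_attained:
  obtains \<sigma> where "\<sigma> permutes {..<n}"
    "min_matching_dist N n u v = (\<Sum>i<n. net_dist N (u i) (v (\<sigma> i)))"
proof -
  have "min_matching_dist N n u v
      \<in> (\<lambda>\<sigma>. \<Sum>i<n. net_dist N (u i) (v (\<sigma> i))) ` {\<sigma>. \<sigma> permutes {..<n}}"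
    unfolding min_matching_dist_def
    by (intro Min_in) (auto simp: finite_permutations intro: exI[of _ id] permutes_id)
  then show thesis using that by auto
qed

text \<open>Weak duality: pair the terms along an optimal matching. Both lower bounds for the
  expectation rest on this inequality.\<close>

lemma lipschitz_le_min_matching:
  assumes "net_lipschitz L \<phi>" "\<And>i. i < n \<Longrightarrow> u i \<in> locations N" "\<And>i. i < n \<Longrightarrow> v i \<in> locations N"
  shows "(\<Sum>i<n. \<phi> (u i)) - (\<Sum>i<n. \<phi> (v i)) \<le> L * min_matching_dist N n u v"
proof -
  obtain \<sigma> where \<sigma>: "\<sigma> permutes {..<n}"
    "min_matching_dist N n u v = (\<Sum>i<n. net_dist N (u i) (v (\<sigma> i)))"
    by (rule min_matching_attained)
  have "(\<Sum>i<n. \<phi> (u i)) - (\<Sum>i<n. \<phi> (v i)) = (\<Sum>i<n. \<phi> (u i) - \<phi> (v (\<sigma> i)))"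
    using sum.permute[OF \<sigma>(1), of "\<lambda>i. \<phi> (v i)"] by (simp add: sum_subtractf comp_def)
  also have "\<dots> \<le> (\<Sum>i<n. L * net_dist N (u i) (v (\<sigma> i)))"
    using assms permutes_in_image[OF \<sigma>(1)]
    by (intro sum_mono net_lipschitzD) (auto simp: lessThan_iff[symmetric] simp del: lessThan_iff)
  finally show ?thesis unfolding \<sigma>(2) by (simp add: sum_distrib_left)
qed

text \<open>Strong duality. The potential is first found on the finite set of matched pairs and then
  extended to all locations. The case \<open>n = 0\<close> is separate because the extension is a
  minimum over the pairs.\<close>

lemma kantorovich_potential:
  assumes "\<And>i. i < n \<Longrightarrow> u i \<in> locations N" "\<And>i. i < n \<Longrightarrow> v i \<in> locations N"
  obtains \<phi> where "net_lipschitz 1 \<phi>"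
    "min_matching_dist N n u v \<le> (\<Sum>i<n. \<phi> (u i)) - (\<Sum>i<n. \<phi> (v i))"
proof (cases "n = 0")
  case True
  have "net_lipschitz 1 (\<lambda>_. 0)"
    unfolding net_lipschitz_def using net_dist_nonneg by simp
  then show thesis using that True by (auto simp: min_matching_dist_def)
next
  case False
  obtain \<sigma> where \<sigma>: "\<sigma> permutes {..<n}"
    "min_matching_dist N n u v = (\<Sum>i<n. net_dist N (u i) (v (\<sigma> i)))"
    by (rule min_matching_attained)
  define d where "d i j = net_dist N (u i) (v (\<sigma> j))" for i j
  have v: "v (\<sigma> i) \<in> locations N" if "i < n" for i
    using assms(2) permutes_in_image[OF \<sigma>(1)] that by auto
  \<comment> \<open>Optimality of \<open>\<sigma>\<close> against the competitor that matches
    \<open>u i\<close> with \<open>v (\<sigma> (\<pi> i))\<close>. The weight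
    \<open>d i j - d i i\<close> is the price of giving \<open>u i\<close> the partner of
    \<open>u j\<close>.\<close>
  have "0 \<le> (\<Sum>i<n. d i (\<pi> i) - d i i)" if "\<pi> permutes {..<n}" for \<pi>
    using min_matching_le[OF permutes_compose[OF that \<sigma>(1)], of u v] \<sigma>(2)
    by (simp add: d_def sum_subtractf)
  then obtain w where w: "\<And>i j. i \<in> {..<n} \<Longrightarrow> j \<in> {..<n} \<Longrightarrow> w i \<le> w j + (d i j - d i i)"
    using potential_exists[of "{..<n}" "\<lambda>i j. d i j - d i i"] by auto
  \<comment> \<open>A McShane extension: a minimum of 1-Lipschitz functions. The inequality for
    \<open>w\<close> says that no \<open>j\<close> makes \<open>\<phi> (u i)\<close> smaller than
    \<open>d i i + w i\<close>, while the choice \<open>j = i\<close> gives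
    \<open>\<phi> (v (\<sigma> i)) \<le> w i\<close>.\<close>
  define \<phi> where "\<phi> p = Min ((\<lambda>j. net_dist N p (v (\<sigma> j)) + w j) ` {..<n})" for p
  have \<phi>_le: "\<phi> p \<le> net_dist N p (v (\<sigma> j)) + w j" if "j < n" for p j
    unfolding \<phi>_def using that by (intro Min_le) auto
  have \<phi>_attained: "\<exists>j<n. \<phi> p = net_dist N p (v (\<sigma> j)) + w j" for p
  proof -
    have "\<phi> p \<in> (\<lambda>j. net_dist N p (v (\<sigma> j)) + w j) ` {..<n}"
      unfolding \<phi>_def using False by (intro Min_in) auto
    then show ?thesis by auto
  qed
  have "net_lipschitz 1 \<phi>"
    unfolding net_lipschitz_def
  proof (intro ballI)
    fix p q assume pq: "p \<in> locations N" "q \<in> locations N"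
    obtain j where "j < n" "\<phi> q = net_dist N q (v (\<sigma> j)) + w j" using \<phi>_attained by blast
    then show "\<phi> p - \<phi> q \<le> 1 * net_dist N p q"
      using \<phi>_le[of j p] net_dist_triangle[OF pq v] by fastforce
  qed
  moreover have "d i i \<le> \<phi> (u i) - \<phi> (v (\<sigma> i))" if "i < n" for i
  proof -
    obtain j where j: "j < n" "\<phi> (u i) = d i j + w j" using \<phi>_attained unfolding d_def by blast
    have "w i \<le> w j + (d i j - d i i)" using w that j(1) by simp
    moreover have "\<phi> (v (\<sigma> i)) \<le> w i" using \<phi>_le[OF that, of "v (\<sigma> i)"] net_dist_refl[OF v[OF that]] by simp
    ultimately show ?thesis using j(2) by simp
  qed
  then have "(\<Sum>i<n. d i i) \<le> (\<Sum>i<n. \<phi> (u i) - \<phi> (v (\<sigma> i)))" by (intro sum_mono) simp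
  then have "min_matching_dist N n u v \<le> (\<Sum>i<n. \<phi> (u i)) - (\<Sum>i<n. \<phi> (v i))"
    using sum.permute[OF \<sigma>(1), of "\<lambda>i. \<phi> (v i)"] \<sigma>(2)
    by (simp add: sum_subtractf comp_def d_def)
  ultimately show thesis by (rule that)
qed

end

section \<open>Imbalance profiles and integration by parts along an edge\<close>

lemma imbalance_eq_sum:
  "real_of_int (imbalance n u v e x) =
    (\<Sum>i<n. of_bool (u i \<in> segment e x)) - (\<Sum>i<n. of_bool (v i \<in> segment e x))"
proof -
  have "real (card {i. i < n \<and> P i}) = (\<Sum>i<n. of_bool (P i))" for P :: "nat \<Rightarrow> bool"
    by (simp add: sum_of_bool_eq Collect_conj_eq[symmetric] lessThan_def)
  then show ?thesis by (simp add: imbalance_def)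
qed

lemma measurable_of_bool_segment [measurable]:
  "(\<lambda>x. of_bool (p \<in> segment e x) :: real) \<in> borel_measurable borel"
proof -
  have "(\<lambda>x. of_bool (p \<in> segment e x) :: real) =
      (\<lambda>x. of_bool (fst p = e \<and> 0 \<le> snd p) * indicator {snd p..} x)"
    by (auto simp: mem_segment indicator_def)
  then show ?thesis by simp
qed

lemma measurable_imbalance [measurable]:
  "(\<lambda>x. real_of_int (imbalance n u v e x)) \<in> borel_measurable borel"
  unfolding imbalance_eq_sum by measurable

lemma imbalance_bound: "\<bar>real_of_int (imbalance n u v e x)\<bar> \<le> real n"
proof -
  have "(\<Sum>i<n. of_bool (P i) :: real) \<in> {0..real n}" for P :: "nat \<Rightarrow> bool"
    using sum_bounded_above[of "{..<n}" "\<lambda>i. of_bool (P i) :: real" 1]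
    by (auto intro: sum_nonneg)
  from this[of "\<lambda>i. u i \<in> segment e x"] this[of "\<lambda>i. v i \<in> segment e x"]
  show ?thesis unfolding imbalance_eq_sum by auto
qed

lemma bounded_set_integrable:
  fixes f :: "real \<Rightarrow> real"
  assumes "f \<in> borel_measurable borel" "\<And>x. \<bar>f x\<bar> \<le> B" "A \<in> sets borel" "A \<subseteq> {a..b}"
  shows "set_integrable lborel A f"
  unfolding set_integrable_def
proof (rule integrableI_bounded_set_indicator)
  have "emeasure lborel A \<le> emeasure lborel {a..b}"
    by (rule emeasure_mono) (use assms in auto)
  then show "emeasure lborel A < \<infinity>"
    by (metis emeasure_compact_finite compact_Icc infinity_ennreal_def order_le_less_trans)
qed (use assms in auto)

lemma imbalance_set_integrable:
  assumes "A \<in> sets borel" "A \<subseteq> {a..b}"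
  shows "set_integrable lborel A (\<lambda>x. \<bar>real_of_int (imbalance n u v e x) - c\<bar>)"
proof (rule bounded_set_integrable[OF _ _ assms])
  fix x show "\<bar>\<bar>real_of_int (imbalance n u v e x) - c\<bar>\<bar> \<le> real n + \<bar>c\<bar>"
    using imbalance_bound[of n u v e x] by auto
qed measurable

lemmas imbalance_integrable_Icc = imbalance_set_integrable[OF _ order_refl, simplified]

lemma set_integral_sum:
  fixes f :: "'i \<Rightarrow> 'a \<Rightarrow> real"
  assumes "\<And>i. i \<in> I \<Longrightarrow> set_integrable M A (f i)"
  shows "(LINT x:A|M. \<Sum>i\<in>I. f i x) = (\<Sum>i\<in>I. LINT x:A|M. f i x)"
  using assms unfolding set_lebesgue_integral_def set_integrable_def scaleR_sum_right
  by (intro Bochner_Integration.integral_sum) auto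

lemma set_integral_mono_subset:
  fixes f :: "'a \<Rightarrow> real"
  assumes "set_integrable M B f" "A \<in> sets M" "A \<subseteq> B" "\<And>x. 0 \<le> f x"
  shows "(LINT x:A|M. f x) \<le> (LINT x:B|M. f x)"
  using set_integrable_subset[OF assms(1-3)] assms
  unfolding set_lebesgue_integral_def set_integrable_def
  by (intro Bochner_Integration.integral_mono) (auto simp: indicator_def)

text \<open>Only the values of \<open>f\<close> on a finite set matter, so the slope of the
  piecewise linear interpolation, a step function, serves as derivative. The induction adds points
  from left to right and appends the slope of the last secant.\<close>

lemma lipschitz_interpolation:
  fixes f :: "real \<Rightarrow> real"
  assumes "finite F" "\<And>x. x \<in> F \<Longrightarrow> 0 \<le> x"
    and "\<And>x y. x \<in> insert 0 F \<Longrightarrow> y \<in> insert 0 F \<Longrightarrow> \<bar>f x - f y\<bar> \<le> \<bar>x - y\<bar>"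
  shows "\<exists>g. g \<in> borel_measurable borel \<and> (\<forall>x. \<bar>g x\<bar> \<le> 1) \<and>
      (\<forall>x\<in>insert 0 F. f x - f 0 = (LBINT t:{0..<x}. g t))"
  using assms
proof (induction F rule: finite_linorder_max_induct)
  case empty
  show ?case by (intro exI[of _ "\<lambda>_. 0"]) auto
next
  case (insert b F)
  then obtain g where g: "g \<in> borel_measurable borel" "\<And>x. \<bar>g x\<bar> \<le> 1"
    and gF: "\<And>x. x \<in> insert 0 F \<Longrightarrow> f x - f 0 = (LBINT t:{0..<x}. g t)"
    by (metis (no_types, lifting) insert_iff)
  define m where "m = Max (insert 0 F)"
  have m_in: "m \<in> insert 0 F" unfolding m_def using insert.hyps(1) by (intro Max_in) auto
  have m_ge: "x \<le> m" if "x \<in> insert 0 F" for x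
    unfolding m_def using insert.hyps(1) that by (intro Max_ge) auto
  have m: "0 \<le> m" "m \<le> b" using m_ge[of 0] m_in insert.hyps(2) insert.prems(1)[of b] by auto
  \<comment> \<open>The new point can coincide with \<open>m\<close> only if both are 0; the
    quotient is then 0 by convention, in agreement with \<open>f b = f m\<close>.\<close>
  define k where "k = (f b - f m) / (b - m)"
  have "\<bar>f b - f m\<bar> \<le> \<bar>b - m\<bar>" using m_in insert.prems(2)[of b m] by auto
  then have k: "\<bar>k\<bar> \<le> 1" "k * (b - m) = f b - f m"
    using m(2) unfolding k_def by (auto simp: abs_divide divide_le_eq)
  define h where "h t = (if t < m then g t else k)" for t
  have h: "h \<in> borel_measurable borel" "\<And>x. \<bar>h x\<bar> \<le> 1"
    using g k(1) unfolding h_def by (auto intro: measurable_If)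
  have hF: "f x - f 0 = (LBINT t:{0..<x}. h t)" if "x \<in> insert 0 F" for x
    unfolding gF[OF that] using m_ge[OF that] by (intro set_lebesgue_integral_cong) (auto simp: h_def)
  have "(LBINT t:{0..<b}. h t) = (LBINT t:{0..<m} \<union> {m..<b}. h t)"
    using m by (simp add: ivl_disj_un)
  also have "\<dots> = (LBINT t:{0..<m}. h t) + (LBINT t:{m..<b}. h t)"
    using h by (intro set_integral_Un bounded_set_integrable[where a = 0 and b = b and B = 1])
      (use m in auto)
  also have "(LBINT t:{m..<b}. h t) = (LBINT t:{m..<b}. k)"
    by (intro set_lebesgue_integral_cong) (auto simp: h_def)
  also have "\<dots> = k * (b - m)" using m by (simp add: set_lebesgue_integral_def)
  finally have "f b - f 0 = (LBINT t:{0..<b}. h t)" using hF[OF m_in] k(2) by simp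
  then have "\<forall>x\<in>insert 0 (insert b F). f x - f 0 = (LBINT t:{0..<x}. h t)"
    using hF by blast
  then show ?case using h by blast
qed

context connected_net
begin

text \<open>Integration by parts. If \<open>g\<close> is the slope of \<open>\<phi>\<close> along
  the edge and \<open>S\<close> the profile, the left side is
  \<open>S(l) \<phi>(l) - \<integral> S g\<close>, and
  \<open>c (\<phi>(l) - \<phi>(0)) = \<integral> c g\<close>. Since \<open>g\<close> is bounded by
  1, the remaining \<open>\<integral> (c - S) g\<close> is at most the value of \<open>Psi\<close>.
  The real number \<open>c\<close> is arbitrary: it will be an integer flow in the program and 0 in
  the square-root bound.\<close>

lemma edge_duality:
  fixes \<phi> :: "'e \<times> real \<Rightarrow> real" and c :: real
  assumes e: "e \<in> edges N" and \<phi>: "net_lipschitz 1 \<phi>"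
    and u: "\<And>i. i < n \<Longrightarrow> u i \<in> locations N" and v: "\<And>i. i < n \<Longrightarrow> v i \<in> locations N"
  shows "(\<Sum>i<n. of_bool (fst (u i) = e) * \<phi> (u i)) - (\<Sum>i<n. of_bool (fst (v i) = e) * \<phi> (v i))
    \<le> imbalance n u v e (len N e) * \<phi> (e, len N e) - c * (\<phi> (e, len N e) - \<phi> (e, 0))
      + Psi N e c (\<lambda>x. real_of_int (imbalance n u v e x))"
proof -
  define l where "l = len N e"
  have l: "0 \<le> l" unfolding l_def by (rule len_nonneg[OF e])
  define f where "f x = \<phi> (e, x)" for x
  \<comment> \<open>The far end and the offsets of all sample points on \<open>e\<close>; together
    with 0 these are the only places where \<open>\<phi>\<close> is evaluated.\<close>
  define F where "F = insert l (snd ` {p \<in> u ` {..<n} \<union> v ` {..<n}. fst p = e})"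
  have F: "0 \<le> x \<and> x \<le> l" if "x \<in> insert 0 F" for x
    using that u v l by (auto simp: F_def mem_locations l_def)
  have lip: "\<bar>f x - f y\<bar> \<le> \<bar>x - y\<bar>" if "x \<in> insert 0 F" "y \<in> insert 0 F" for x y
  proof -
    have "(e, x) \<in> locations N" "(e, y) \<in> locations N"
      using F[OF that(1)] F[OF that(2)] e by (auto simp: mem_locations l_def)
    then show ?thesis using net_lipschitz_abs[OF \<phi>] net_dist_edge unfolding f_def by fastforce
  qed
  have "finite F" by (simp add: F_def)
  then have "\<exists>g. g \<in> borel_measurable borel \<and> (\<forall>x. \<bar>g x\<bar> \<le> 1) \<and>
      (\<forall>x\<in>insert 0 F. f x - f 0 = (LBINT t:{0..<x}. g t))"
    by (rule lipschitz_interpolation) (use F lip in blast)+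
  then obtain g where g [measurable]: "g \<in> borel_measurable borel" and g1: "\<And>x. \<bar>g x\<bar> \<le> 1"
    and gF: "\<And>x. x \<in> insert 0 F \<Longrightarrow> f x - f 0 = (LBINT t:{0..<x}. g t)"
    by blast
  have int: "set_integrable lborel A h"
    if "h \<in> borel_measurable borel" "\<And>x. \<bar>h x\<bar> \<le> B" "A \<in> sets borel" "A \<subseteq> {0..l}" for h :: "real \<Rightarrow> real" and B A
    by (rule bounded_set_integrable[where B = B and a = 0 and b = l]) (use that in auto)
  \<comment> \<open>The contribution of a single point at offset \<open>x\<close> is
    \<open>f l - f x\<close>, the integral of \<open>g\<close> from \<open>x\<close> to
    \<open>l\<close>: as a function of \<open>t\<close>, membership in \<open>segment e t\<close>
    switches on at \<open>x\<close>.\<close>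
  have pt: "of_bool (p \<in> segment e l) * f l - of_bool (fst p = e) * \<phi> p
      = (LBINT t:{0..<l}. of_bool (p \<in> segment e t) * g t)"
    if "p \<in> u ` {..<n} \<union> v ` {..<n}" for p
  proof (cases "fst p = e")
    case True
    define x where "x = snd p"
    have p: "p = (e, x)" using True by (simp add: x_def prod_eq_iff)
    have "x \<in> F" unfolding F_def x_def using True that by auto
    then have x: "0 \<le> x" "x \<le> l" using F by auto
    have "(LBINT t:{0..<l}. g t) = (LBINT t:{0..<x} \<union> {x..<l}. g t)"
      using x by (simp add: ivl_disj_un)
    also have "\<dots> = (LBINT t:{0..<x}. g t) + (LBINT t:{x..<l}. g t)"
      by (intro set_integral_Un int[OF g g1]) (use x in auto)
    also have "(LBINT t:{x..<l}. g t) = (LBINT t:{0..<l}. of_bool (p \<in> segment e t) * g t)"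
      unfolding set_lebesgue_integral_def using x
      by (intro Bochner_Integration.integral_cong) (auto simp: p mem_segment indicator_def)
    finally have "(LBINT t:{0..<l}. of_bool (p \<in> segment e t) * g t) = f l - f x"
      using gF[of l] gF[of x] \<open>x \<in> F\<close> by (auto simp: F_def)
    then show ?thesis using x by (simp add: p mem_segment f_def)
  next
    case False
    then show ?thesis by (simp add: mem_segment set_lebesgue_integral_def)
  qed
  have pt_sum: "(\<Sum>i<n. of_bool (w i \<in> segment e l)) * f l - (\<Sum>i<n. of_bool (fst (w i) = e) * \<phi> (w i))
      = (LBINT t:{0..<l}. (\<Sum>i<n. of_bool (w i \<in> segment e t)) * g t)"
    if "w ` {..<n} \<subseteq> u ` {..<n} \<union> v ` {..<n}" for w
  proof -
    have "(\<Sum>i<n. of_bool (w i \<in> segment e l)) * f l - (\<Sum>i<n. of_bool (fst (w i) = e) * \<phi> (w i))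
      = (\<Sum>i<n. LBINT t:{0..<l}. of_bool (w i \<in> segment e t) * g t)"
      unfolding sum_distrib_right sum_subtractf[symmetric]
      using that by (intro sum.cong refl pt) auto
    also have "\<dots> = (LBINT t:{0..<l}. \<Sum>i<n. of_bool (w i \<in> segment e t) * g t)"
      by (rule set_integral_sum[symmetric], rule int[where B = 1])
        (auto simp: abs_mult intro: g1)
    finally show ?thesis by (simp add: sum_distrib_right)
  qed
  let ?S = "\<lambda>x. real_of_int (imbalance n u v e x)"
  have sum_bd: "\<bar>(\<Sum>i<n. of_bool (w i \<in> segment e t)) * g t\<bar> \<le> real n" for w :: "nat \<Rightarrow> 'e \<times> real" and t
  proof -
    have "\<bar>\<Sum>i<n. of_bool (w i \<in> segment e t) :: real\<bar> \<le> (\<Sum>i<n. 1)"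
      by (rule order_trans[OF sum_abs sum_mono]) auto
    then have "\<bar>(\<Sum>i<n. of_bool (w i \<in> segment e t)) * g t\<bar> \<le> real n * 1"
      unfolding abs_mult using g1[of t] by (intro mult_mono) auto
    then show ?thesis by simp
  qed
  have "?S l * f l - ((\<Sum>i<n. of_bool (fst (u i) = e) * \<phi> (u i)) - (\<Sum>i<n. of_bool (fst (v i) = e) * \<phi> (v i)))
      = (LBINT t:{0..<l}. (\<Sum>i<n. of_bool (u i \<in> segment e t)) * g t)
        - (LBINT t:{0..<l}. (\<Sum>i<n. of_bool (v i \<in> segment e t)) * g t)"
    using pt_sum[of u] pt_sum[of v] unfolding imbalance_eq_sum by (simp add: left_diff_distrib)
  also have "\<dots> = (LBINT t:{0..<l}. ?S t * g t)"
    unfolding imbalance_eq_sum left_diff_distrib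
    by (rule set_integral_diff(2)[symmetric]; rule int[where B = "real n"])
       (auto simp del: sum_of_bool_eq intro: sum_bd)
  finally have S: "(\<Sum>i<n. of_bool (fst (u i) = e) * \<phi> (u i)) - (\<Sum>i<n. of_bool (fst (v i) = e) * \<phi> (v i))
      = ?S l * f l - (LBINT t:{0..<l}. ?S t * g t)" by simp
  have c: "c * (f l - f 0) = (LBINT t:{0..<l}. c * g t)"
    using gF[of l] by (simp add: F_def)
  have Sg: "set_integrable lborel {0..<l} (\<lambda>t. ?S t * g t)"
  proof (rule int)
    show "\<bar>?S t * g t\<bar> \<le> real n * 1" for t
      unfolding abs_mult using g1[of t] imbalance_bound[of n u v e t] by (intro mult_mono) auto
  qed auto
  have cg: "set_integrable lborel {0..<l} (\<lambda>t. c * g t)"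
    by (intro set_integrable_mult_right int[OF g g1]) auto
  have "c * (f l - f 0) - (LBINT t:{0..<l}. ?S t * g t) = (LBINT t:{0..<l}. c * g t - ?S t * g t)"
    unfolding c using set_integral_diff(2)[OF cg Sg] by simp
  also have "\<dots> \<le> (LBINT t:{0..<l}. \<bar>?S t - c\<bar>)"
  proof (rule set_integral_mono[OF set_integral_diff(1)[OF cg Sg] imbalance_set_integrable[where a = 0 and b = l]])
    fix t
    have "c * g t - ?S t * g t \<le> \<bar>(c - ?S t) * g t\<bar>" by (simp add: left_diff_distrib)
    also have "\<dots> \<le> \<bar>?S t - c\<bar> * 1"
      unfolding abs_mult using g1[of t] by (intro mult_mono) auto
    finally show "c * g t - ?S t * g t \<le> \<bar>?S t - c\<bar>" by simp
  qed auto
  also have "\<dots> \<le> (LBINT t:{0..l}. \<bar>?S t - c\<bar>)"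
    by (rule set_integral_mono_subset[OF imbalance_set_integrable[where a = 0 and b = l]]) auto
  finally show ?thesis using S unfolding Psi_def l_def f_def by linarith
qed

section \<open>The integer program computes the minimum matching distance\<close>

lemma cf_cost_nonneg: "0 \<le> cf_cost N n u v c"
  unfolding cf_cost_def Psi_def set_lebesgue_integral_def
  by (intro sum_nonneg Bochner_Integration.integral_nonneg) auto

lemma sum_by_edge:
  assumes "\<And>i. i < n \<Longrightarrow> w i \<in> locations N"
  shows "(\<Sum>e\<in>edges N. \<Sum>i<n. of_bool (fst (w i) = e) * f (w i)) = (\<Sum>i<n. f (w i) :: real)"
proof -
  have "(\<Sum>e\<in>edges N. of_bool (fst (w i) = e) * f (w i)) = f (w i)" if "i < n" for i
  proof -
    have "(\<Sum>e\<in>edges N. of_bool (fst (w i) = e) * f (w i))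
        = (\<Sum>e\<in>edges N. if e = fst (w i) then f (w i) else 0)"
      by (rule sum.cong) auto
    then show ?thesis using assms[OF that] finite_edges by (simp add: mem_locations sum.delta)
  qed
  then show ?thesis by (subst sum.swap, intro sum.cong) auto
qed

lemma min_matching_le_cf_cost:
  assumes u: "\<And>i. i < n \<Longrightarrow> u i \<in> locations N" and v: "\<And>i. i < n \<Longrightarrow> v i \<in> locations N"
    and feas: "cf_feasible N n u v c"
  shows "min_matching_dist N n u v \<le> cf_cost N n u v c"
proof -
  obtain \<phi> where \<phi>: "net_lipschitz 1 \<phi>"
    and le: "min_matching_dist N n u v \<le> (\<Sum>i<n. \<phi> (u i)) - (\<Sum>i<n. \<phi> (v i))"
    using kantorovich_potential[of n u v] u v by blast
  \<comment> \<open>Records of one node are at distance 0, so \<open>\<phi>\<close> descends to a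
    function on nodes. A node without records gets an arbitrary value, which is harmless because no
    edge meets it.\<close>
  define \<psi> where "\<psi> a = \<phi> (SOME p. located_at N p a)" for a
  have \<psi>: "\<phi> p = \<psi> a" if "located_at N p a" for p a
  proof -
    define q where "q = (SOME p. located_at N p a)"
    have q: "located_at N q a" unfolding q_def using that by (rule someI)
    have "\<bar>\<phi> p - \<phi> q\<bar> \<le> 1 * net_dist N p q"
      using \<phi> that q by (intro net_lipschitz_abs located_at_locations)
    then show ?thesis using net_dist_node[OF that q] by (simp add: \<psi>_def q_def)
  qed
  define s where "s e = imbalance n u v e (len N e)" for e
  have "(\<Sum>i<n. \<phi> (u i)) - (\<Sum>i<n. \<phi> (v i))
    = (\<Sum>e\<in>edges N. (\<Sum>i<n. of_bool (fst (u i) = e) * \<phi> (u i))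
        - (\<Sum>i<n. of_bool (fst (v i) = e) * \<phi> (v i)))"
    using sum_by_edge[of n u, OF u] sum_by_edge[of n v, OF v] by (simp add: sum_subtractf)
  also have "\<dots> \<le> (\<Sum>e\<in>edges N. s e * \<psi> (head N e) - c e * (\<psi> (head N e) - \<psi> (tail N e))
      + Psi N e (c e) (\<lambda>x. real_of_int (imbalance n u v e x)))"
  proof (rule sum_mono)
    fix e assume e: "e \<in> edges N"
    show "(\<Sum>i<n. of_bool (fst (u i) = e) * \<phi> (u i)) - (\<Sum>i<n. of_bool (fst (v i) = e) * \<phi> (v i))
      \<le> s e * \<psi> (head N e) - c e * (\<psi> (head N e) - \<psi> (tail N e))
      + Psi N e (c e) (\<lambda>x. real_of_int (imbalance n u v e x))"
      using edge_duality[OF e \<phi>, of n u v "real_of_int (c e)"] u v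
        \<psi>[OF located_at_head[OF e]] \<psi>[OF located_at_tail[OF e]] by (simp add: s_def)
  qed
  also have "\<dots> = (\<Sum>e\<in>edges N. s e * \<psi> (head N e) - c e * (\<psi> (head N e) - \<psi> (tail N e)))
      + cf_cost N n u v c"
    by (simp add: cf_cost_def sum.distrib)
  \<comment> \<open>Regrouped by nodes, the boundary terms become multiples of the residuals of the
    flow equations; each edge contributes at its head and at its tail.\<close>
  also have "(\<Sum>e\<in>edges N. s e * \<psi> (head N e) - c e * (\<psi> (head N e) - \<psi> (tail N e)))
      = (\<Sum>e\<in>edges N. \<Sum>a\<in>nodes N. \<psi> a * (inc_plus N a e * s e - inc N a e * c e))"
  proof (rule sum.cong[OF refl])
    fix e assume e: "e \<in> edges N"
    have "(\<Sum>a\<in>nodes N. \<psi> a * (inc_plus N a e * s e - inc N a e * c e))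
      = (\<Sum>a\<in>nodes N. (if head N e = a then \<psi> a * (s e - c e) else 0)
          + (if tail N e = a then \<psi> a * c e else 0))"
      by (rule sum.cong) (auto simp: inc_def inc_plus_def inc_minus_def algebra_simps)
    also have "\<dots> = \<psi> (head N e) * (s e - c e) + \<psi> (tail N e) * c e"
      using e by (simp add: sum.distrib sum.delta finite_nodes head_in_nodes tail_in_nodes)
    finally show "s e * \<psi> (head N e) - c e * (\<psi> (head N e) - \<psi> (tail N e))
      = (\<Sum>a\<in>nodes N. \<psi> a * (inc_plus N a e * s e - inc N a e * c e))"
      by (simp add: algebra_simps)
  qed
  also have "\<dots> = (\<Sum>a\<in>nodes N. \<psi> a * (\<Sum>e\<in>edges N. inc_plus N a e * s e - inc N a e * c e))"
    unfolding of_int_sum sum_distrib_left by (rule sum.swap)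
  also have "\<dots> = 0"
  proof (rule sum.neutral, rule ballI)
    fix a assume "a \<in> nodes N"
    then have "(\<Sum>e\<in>edges N. inc_plus N a e * s e - inc N a e * c e) = 0"
      using feas by (simp add: cf_feasible_def s_def sum_subtractf)
    then have "(\<Sum>e\<in>edges N. real_of_int (inc_plus N a e * s e - inc N a e * c e)) = 0"
      using arg_cong[of _ _ real_of_int] by fastforce
    then show "\<psi> a * (\<Sum>e\<in>edges N. inc_plus N a e * s e - inc N a e * c e) = 0" by simp
  qed
  finally show ?thesis using le by simp
qed

lemma imbalance_single:
  "imbalance 1 (\<lambda>_. p) (\<lambda>_. q) e x = of_bool (p \<in> segment e x) - of_bool (q \<in> segment e x)"
proof -
  have "card {i::nat. i < 1 \<and> P} = of_bool P" for P by (cases P) auto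
  then show ?thesis by (simp add: imbalance_def)
qed

text \<open>Induction on the route. A move keeps \<open>c\<close>: the count at the far end of the
  edge stays the same, and the profile changes by one precisely between the old and the new offset,
  which costs at most the length moved. A switch costs nothing, because \<open>c\<close> absorbs the
  change of the profile up to a null set.\<close>

lemma route_flow:
  assumes "travel N p q r"
  shows "\<exists>c. cf_feasible N 1 (\<lambda>_. p) (\<lambda>_. q) c \<and> cf_cost N 1 (\<lambda>_. p) (\<lambda>_. q) c \<le> r"
  using assms
proof (induction rule: travel.induct)
  case stay
  show ?case
    by (intro exI[of _ "\<lambda>_. 0"])
      (simp add: cf_feasible_def cf_cost_def Psi_def imbalance_def set_lebesgue_integral_def)
next
  case (move e x r y)
  have loc: "(e, x) \<in> locations N" by (rule travel_locations(2)[OF move.hyps(1)])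
  obtain c where c: "cf_feasible N 1 (\<lambda>_. p) (\<lambda>_. (e, x)) c"
    "cf_cost N 1 (\<lambda>_. p) (\<lambda>_. (e, x)) c \<le> r" using move.IH by blast
  let ?S = "\<lambda>z f t. real_of_int (imbalance 1 (\<lambda>_. p) (\<lambda>_. (e, z)) f t)"
  have "imbalance 1 (\<lambda>_. p) (\<lambda>_. (e, y)) f (len N f) = imbalance 1 (\<lambda>_. p) (\<lambda>_. (e, x)) f (len N f)" for f
    unfolding imbalance_single using loc move.hyps(2) by (auto simp: mem_segment mem_locations)
  then have feas: "cf_feasible N 1 (\<lambda>_. p) (\<lambda>_. (e, y)) c"
    using c(1) by (simp add: cf_feasible_def)
  have "Psi N f (c f) (?S y f) \<le> Psi N f (c f) (?S x f) + (if f = e then \<bar>x - y\<bar> else 0)" for f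
  proof (cases "f = e")
    case True
    have int: "set_integrable lborel {0..len N f} (indicator {min x y..<max x y} :: real \<Rightarrow> real)"
      by (rule bounded_set_integrable[where B = 1]) (auto simp: indicator_def)
    have "Psi N f (c f) (?S y f)
        \<le> (LBINT t:{0..len N f}. \<bar>?S x f t - c f\<bar> + indicator {min x y..<max x y} t)"
      unfolding Psi_def
    proof (rule set_integral_mono[OF imbalance_integrable_Icc
          set_integral_add(1)[OF imbalance_integrable_Icc int]])
      fix t assume t: "t \<in> {0..len N f}"
      have "?S y f t = ?S x f t + of_bool ((e, x) \<in> segment f t) - of_bool ((e, y) \<in> segment f t)"
        unfolding imbalance_single by simp
      then show "\<bar>?S y f t - c f\<bar> \<le> \<bar>?S x f t - c f\<bar> + indicator {min x y..<max x y} t"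
        using loc move.hyps(2) by (auto simp: mem_segment True mem_locations indicator_def)
    qed
    also have "\<dots> = Psi N f (c f) (?S x f) + (LBINT t:{0..len N f}. indicator {min x y..<max x y} t :: real)"
      unfolding Psi_def by (rule set_integral_add(2)[OF imbalance_integrable_Icc int])
    also have "(LBINT t:{0..len N f}. indicator {min x y..<max x y} t :: real)
        \<le> (LBINT t:UNIV. indicator {min x y..<max x y} t :: real)"
      by (rule set_integral_mono_subset) (auto simp: set_integrable_def)
    also have "\<dots> = \<bar>x - y\<bar>" by (simp add: set_lebesgue_integral_def)
    finally show ?thesis by (simp add: True)
  next
    case False
    then have "?S y f = ?S x f" unfolding imbalance_single by (auto simp: mem_segment)
    then show ?thesis using False by simp
  qed
  then have "cf_cost N 1 (\<lambda>_. p) (\<lambda>_. (e, y)) c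
    \<le> (\<Sum>f\<in>edges N. Psi N f (c f) (?S x f) + (if f = e then \<bar>x - y\<bar> else 0))"
    unfolding cf_cost_def by (rule sum_mono)
  also have "\<dots> \<le> cf_cost N 1 (\<lambda>_. p) (\<lambda>_. (e, x)) c + \<bar>x - y\<bar>"
    using finite_edges by (simp add: sum.distrib cf_cost_def sum.delta)
  finally have "cf_cost N 1 (\<lambda>_. p) (\<lambda>_. (e, y)) c \<le> r + \<bar>x - y\<bar>" using c(2) by simp
  with feas show ?case by blast
next
  case (switch q r a q')
  obtain c where c: "cf_feasible N 1 (\<lambda>_. p) (\<lambda>_. q) c"
    "cf_cost N 1 (\<lambda>_. p) (\<lambda>_. q) c \<le> r" using switch.IH by blast
  \<comment> \<open>A point located at \<open>a\<close> and recorded at the start of its edge is counted throughout that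
    edge; one recorded at the end of its edge is counted at that end only.\<close>
  define \<delta> :: "'e \<times> real \<Rightarrow> 'e \<Rightarrow> int"
    where "\<delta> s f = of_bool (f = fst s \<and> snd s = 0 \<and> tail N (fst s) = a)" for s f
  define c' where "c' f = c f + \<delta> q f - \<delta> q' f" for f
  \<comment> \<open>The net contribution of a record of \<open>a\<close> to the flow equations
    depends on the node alone, so replacing \<open>q\<close> by \<open>q'\<close> and
    \<open>c\<close> by \<open>c'\<close> preserves feasibility.\<close>
  have \<delta>_node: "(\<Sum>f\<in>edges N. inc N b f * \<delta> s f - inc_plus N b f * of_bool (s \<in> segment f (len N f)))
      = - of_bool (a = b)" if "located_at N s a" for s b
  proof -
    have s: "s \<in> locations N" by (rule located_at_locations[OF that])
    have "(\<Sum>f\<in>edges N. inc N b f * \<delta> s f - inc_plus N b f * of_bool (s \<in> segment f (len N f)))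
      = (\<Sum>f\<in>edges N. if f = fst s then - of_bool (a = b) else 0)"
      using that s
      by (intro sum.cong)
        (auto simp: \<delta>_def located_at_def mem_locations mem_segment inc_def inc_plus_def inc_minus_def)
    then show ?thesis using s finite_edges by (simp add: mem_locations sum.delta)
  qed
  \<comment> \<open>The profile of a node record agrees with the constant \<open>\<delta>\<close>
    except possibly at the far end of the edge.\<close>
  have \<delta>_edge: "AE t in lborel. t \<in> {0..len N f} \<longrightarrow> of_bool (s \<in> segment f t) = \<delta> s f"
    if "located_at N s a" for s f
    using AE_lborel_singleton[of "len N f"]
  proof eventually_elim
    case (elim t)
    then show ?case using that by (auto simp: \<delta>_def located_at_def mem_segment)
  qed
  let ?S = "\<lambda>s f t. imbalance 1 (\<lambda>_. p) (\<lambda>_. s) f t"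
  have S: "?S q' f t = ?S q f t + of_bool (q \<in> segment f t) - of_bool (q' \<in> segment f t)" for f t
    unfolding imbalance_single by simp
  have "cf_feasible N 1 (\<lambda>_. p) (\<lambda>_. q') c'"
    unfolding cf_feasible_def
  proof
    fix b assume b: "b \<in> nodes N"
    show "(\<Sum>f\<in>edges N. inc N b f * c' f) = (\<Sum>f\<in>edges N. inc_plus N b f * ?S q' f (len N f))"
      using c(1) b \<delta>_node[OF switch.hyps(2), of b] \<delta>_node[OF switch.hyps(3), of b]
      by (simp add: cf_feasible_def c'_def S sum_subtractf sum.distrib right_diff_distrib distrib_left
          del: One_nat_def)
  qed
  moreover have "Psi N f (c' f) (\<lambda>t. real_of_int (?S q' f t)) = Psi N f (c f) (\<lambda>t. real_of_int (?S q f t))" for f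
    unfolding Psi_def set_lebesgue_integral_def
  proof (rule integral_cong_AE)
    show "AE t in lborel. indicator {0..len N f} t *\<^sub>R \<bar>real_of_int (?S q' f t) - c' f\<bar>
        = indicator {0..len N f} t *\<^sub>R \<bar>real_of_int (?S q f t) - c f\<bar>"
      using \<delta>_edge[OF switch.hyps(2), of f] \<delta>_edge[OF switch.hyps(3), of f]
    proof eventually_elim
      case (elim t)
      then show ?case by (cases "t \<in> {0..len N f}") (simp_all add: S c'_def del: One_nat_def)
    qed
  qed auto
  ultimately show ?case using c(2) by (intro exI[of _ c']) (simp add: cf_cost_def)
qed

text \<open>The flow equations are linear in the sample and in \<open>c\<close>, and the cost is
  subadditive by the triangle inequality, so the flows of the matched pairs can be added.\<close>

lemma min_matching_flow:
  assumes u: "\<And>i. i < n \<Longrightarrow> u i \<in> locations N" and v: "\<And>i. i < n \<Longrightarrow> v i \<in> locations N"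
    and "0 < \<epsilon>"
  shows "\<exists>c. cf_feasible N n u v c \<and> cf_cost N n u v c \<le> min_matching_dist N n u v + \<epsilon>"
proof -
  obtain \<sigma> where \<sigma>: "\<sigma> permutes {..<n}"
    "min_matching_dist N n u v = (\<Sum>i<n. net_dist N (u i) (v (\<sigma> i)))"
    by (rule min_matching_attained)
  \<comment> \<open>Each of the \<open>n\<close> pairs may exceed its distance by
    \<open>\<eta>\<close>; the denominator \<open>n + 1\<close> stays positive for
    \<open>n = 0\<close>.\<close>
  define \<eta> where "\<eta> = \<epsilon> / (real n + 1)"
  have \<eta>: "0 < \<eta>" "real n * \<eta> \<le> \<epsilon>" using \<open>0 < \<epsilon>\<close> by (auto simp: \<eta>_def field_simps)
  have "\<exists>c. cf_feasible N 1 (\<lambda>_. u i) (\<lambda>_. v (\<sigma> i)) c \<and>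
      cf_cost N 1 (\<lambda>_. u i) (\<lambda>_. v (\<sigma> i)) c \<le> net_dist N (u i) (v (\<sigma> i)) + \<eta>" if i: "i < n" for i
  proof -
    have "v (\<sigma> i) \<in> locations N" using v permutes_in_image[OF \<sigma>(1)] i by auto
    then obtain r where "travel N (u i) (v (\<sigma> i)) r" "r < net_dist N (u i) (v (\<sigma> i)) + \<eta>"
      using net_dist_approx[OF u[OF i] _ \<eta>(1)] by blast
    then show ?thesis using route_flow by (meson less_imp_le order_trans)
  qed
  then obtain C where C: "\<And>i. i < n \<Longrightarrow> cf_feasible N 1 (\<lambda>_. u i) (\<lambda>_. v (\<sigma> i)) (C i)"
    "\<And>i. i < n \<Longrightarrow> cf_cost N 1 (\<lambda>_. u i) (\<lambda>_. v (\<sigma> i)) (C i) \<le> net_dist N (u i) (v (\<sigma> i)) + \<eta>"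
    using bchoice[of "{..<n}" "\<lambda>i c. cf_feasible N 1 (\<lambda>_. u i) (\<lambda>_. v (\<sigma> i)) c \<and>
      cf_cost N 1 (\<lambda>_. u i) (\<lambda>_. v (\<sigma> i)) c \<le> net_dist N (u i) (v (\<sigma> i)) + \<eta>"] by auto
  define c where "c e = (\<Sum>i<n. C i e)" for e
  let ?S = "\<lambda>i e x. imbalance 1 (\<lambda>_. u i) (\<lambda>_. v (\<sigma> i)) e x"
  have S: "imbalance n u v e x = (\<Sum>i<n. ?S i e x)" for e x
  proof -
    have "real_of_int (imbalance n u v e x) = (\<Sum>i<n. real_of_int (?S i e x))"
      using sum.permute[OF \<sigma>(1), of "\<lambda>i. of_bool (v i \<in> segment e x) :: real"]
      unfolding imbalance_single imbalance_eq_sum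
      by (simp add: sum_subtractf comp_def del: sum_of_bool_eq)
    then show ?thesis by (simp only: of_int_sum[symmetric] of_int_eq_iff)
  qed
  have feas: "cf_feasible N n u v c"
    unfolding cf_feasible_def
  proof
    fix a assume a: "a \<in> nodes N"
    have "(\<Sum>e\<in>edges N. inc N a e * c e) = (\<Sum>i<n. \<Sum>e\<in>edges N. inc N a e * C i e)"
      unfolding c_def sum_distrib_left by (rule sum.swap)
    also have "\<dots> = (\<Sum>i<n. \<Sum>e\<in>edges N. inc_plus N a e * ?S i e (len N e))"
      by (rule sum.cong) (use C(1) a in \<open>auto simp: cf_feasible_def\<close>)
    also have "\<dots> = (\<Sum>e\<in>edges N. inc_plus N a e * imbalance n u v e (len N e))"
      unfolding S sum_distrib_left by (rule sum.swap)
    finally show "(\<Sum>e\<in>edges N. inc N a e * c e)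
      = (\<Sum>e\<in>edges N. inc_plus N a e * imbalance n u v e (len N e))" .
  qed
  have "Psi N e (c e) (\<lambda>x. real_of_int (imbalance n u v e x))
      \<le> (\<Sum>i<n. Psi N e (C i e) (\<lambda>x. real_of_int (?S i e x)))" for e
  proof -
    have int: "set_integrable lborel {0..len N e} (\<lambda>x. \<Sum>i<n. \<bar>real_of_int (?S i e x) - C i e\<bar>)"
      unfolding set_integrable_def scaleR_sum_right
      by (intro Bochner_Integration.integrable_sum imbalance_integrable_Icc[unfolded set_integrable_def])
    have "Psi N e (c e) (\<lambda>x. real_of_int (imbalance n u v e x))
      \<le> (LBINT x:{0..len N e}. \<Sum>i<n. \<bar>real_of_int (?S i e x) - C i e\<bar>)"
      unfolding Psi_def
    proof (rule set_integral_mono[OF imbalance_integrable_Icc int])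
      fix x
      show "\<bar>real_of_int (imbalance n u v e x) - c e\<bar> \<le> (\<Sum>i<n. \<bar>real_of_int (?S i e x) - C i e\<bar>)"
        unfolding S c_def of_int_sum sum_subtractf[symmetric] by (rule sum_abs)
    qed
    also have "\<dots> = (\<Sum>i<n. Psi N e (C i e) (\<lambda>x. real_of_int (?S i e x)))"
      unfolding Psi_def by (rule set_integral_sum) (auto intro: imbalance_integrable_Icc)
    finally show ?thesis .
  qed
  then have "cf_cost N n u v c
      \<le> (\<Sum>e\<in>edges N. \<Sum>i<n. Psi N e (C i e) (\<lambda>x. real_of_int (?S i e x)))"
    unfolding cf_cost_def by (rule sum_mono)
  also have "\<dots> = (\<Sum>i<n. cf_cost N 1 (\<lambda>_. u i) (\<lambda>_. v (\<sigma> i)) (C i))"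
    unfolding cf_cost_def by (rule sum.swap)
  also have "\<dots> \<le> (\<Sum>i<n. net_dist N (u i) (v (\<sigma> i)) + \<eta>)"
    using C(2) by (intro sum_mono) auto
  also have "\<dots> = (\<Sum>i<n. net_dist N (u i) (v (\<sigma> i))) + real n * \<eta>"
    by (simp add: sum.distrib)
  also have "\<dots> \<le> min_matching_dist N n u v + \<epsilon>" using \<eta>(2) \<sigma>(2) by linarith
  finally show ?thesis using feas by blast
qed

theorem Z_CF_eq_min_matching_dist:
  assumes u: "\<And>i. i < n \<Longrightarrow> u i \<in> locations N" and v: "\<And>i. i < n \<Longrightarrow> v i \<in> locations N"
  shows "Z_CF N n u v = min_matching_dist N n u v"
proof (rule antisym)
  show "Z_CF N n u v \<le> min_matching_dist N n u v"
  proof (rule field_le_epsilon)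
    fix \<epsilon> :: real assume "0 < \<epsilon>"
    then obtain c where c: "cf_feasible N n u v c"
      "cf_cost N n u v c \<le> min_matching_dist N n u v + \<epsilon>"
      using min_matching_flow[of n u v \<epsilon>, OF u v] by blast
    have "Z_CF N n u v \<le> cf_cost N n u v c"
      unfolding Z_CF_def using c(1) cf_cost_nonneg
      by (intro cINF_lower) (auto intro!: bdd_belowI[of _ 0])
    then show "Z_CF N n u v \<le> min_matching_dist N n u v + \<epsilon>" using c(2) by simp
  qed
  show "min_matching_dist N n u v \<le> Z_CF N n u v"
    \<comment> \<open>The flow with slack 1 serves only to show that the feasible set is nonempty,
      without which a lower bound says nothing about the infimum.\<close>
    unfolding Z_CF_def using min_matching_flow[of n u v 1, OF u v] min_matching_le_cf_cost[of n u v, OF u v]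
    by (intro cINF_greatest) auto
qed

section \<open>Measurability\<close>

lemma segment_subset_locations: "e \<in> edges N \<Longrightarrow> x \<le> len N e \<Longrightarrow> segment e x \<subseteq> locations N"
  by (auto simp: mem_segment mem_locations)

lemma generators_subset:
  "{segment e x | e x. e \<in> edges N \<and> 0 \<le> x \<and> x \<le> len N e} \<subseteq> Pow (locations N)"
  using segment_subset_locations by auto

lemma space_location_algebra: "space (location_algebra N) = locations N"
  unfolding location_algebra_def by (rule space_measure_of[OF generators_subset])

lemma sets_location_algebra:
  "sets (location_algebra N) =
    sigma_sets (locations N) {segment e x | e x. e \<in> edges N \<and> 0 \<le> x \<and> x \<le> len N e}"
  unfolding location_algebra_def by (rule sets_measure_of[OF generators_subset])

lemma segment_in_sets:
  assumes "e \<in> edges N" shows "{p \<in> locations N. p \<in> segment e x} \<in> sets (location_algebra N)"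
proof (cases "0 \<le> x")
  case True
  have "{p \<in> locations N. p \<in> segment e x} = segment e (min x (len N e))"
    using assms by (auto simp: mem_segment mem_locations)
  also have "\<dots> \<in> sets (location_algebra N)"
    unfolding sets_location_algebra using True len_nonneg[OF assms] assms
    by (intro sigma_sets.Basic CollectI exI[of _ e] exI[of _ "min x (len N e)"]) auto
  finally show ?thesis .
next
  case False
  then have "{p \<in> locations N. p \<in> segment e x} = {}" by (auto simp: mem_segment)
  then show ?thesis by (simp only: sets.empty_sets)
qed

lemma measurable_snd_location: "snd \<in> borel_measurable (location_algebra N)"
proof (rule borel_measurableI_le)
  fix y :: real
  have "{p \<in> space (location_algebra N). snd p \<le> y} =
      (\<Union>e\<in>edges N. {p \<in> locations N. p \<in> segment e y})"
    unfolding space_location_algebra by (auto simp: mem_segment mem_locations)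
  also have "\<dots> \<in> sets (location_algebra N)"
    using finite_edges segment_in_sets by (intro sets.finite_UN) auto
  finally show "{p \<in> space (location_algebra N). snd p \<le> y} \<in> sets (location_algebra N)" .
qed

lemma edge_in_sets: "{p \<in> locations N. fst p = e} \<in> sets (location_algebra N)"
proof (cases "e \<in> edges N")
  case True
  have "{p \<in> locations N. fst p = e} = {p \<in> locations N. p \<in> segment e (len N e)}"
    by (auto simp: mem_segment mem_locations)
  then show ?thesis using segment_in_sets[OF True] by simp
next
  case False
  then have "{p \<in> locations N. fst p = e} = {}" by (auto simp: mem_locations)
  then show ?thesis by (metis sets.empty_sets)
qed

lemma measurable_fst_location: "fst \<in> measurable (location_algebra N) (count_space (edges N))"
proof (subst measurable_count_space_eq2[OF finite_edges], intro conjI ballI)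
  show "fst \<in> space (location_algebra N) \<rightarrow> edges N"
    unfolding space_location_algebra by (auto simp: mem_locations)
  fix e
  have "fst -` {e} \<inter> space (location_algebra N) = {p \<in> locations N. fst p = e}"
    unfolding space_location_algebra by auto
  then show "fst -` {e} \<inter> space (location_algebra N) \<in> sets (location_algebra N)"
    using edge_in_sets by simp
qed

text \<open>A retraction of the real line onto an edge. It turns a function on the edge into one on
  all reals, where continuity yields Borel measurability.\<close>

definition edge_clamp :: "'e \<Rightarrow> real \<Rightarrow> 'e \<times> real" where
  "edge_clamp e x = (e, max 0 (min x (len N e)))"

lemma edge_clamp_in_locations: "e \<in> edges N \<Longrightarrow> edge_clamp e x \<in> locations N"
  using len_nonneg by (auto simp: edge_clamp_def mem_locations)

lemma edge_clamp_location: "(e, x) \<in> locations N \<Longrightarrow> edge_clamp e x = (e, x)"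
  by (auto simp: edge_clamp_def mem_locations)

lemma net_dist_clamp:
  assumes "e \<in> edges N" shows "net_dist N (edge_clamp e x) (edge_clamp e y) \<le> \<bar>x - y\<bar>"
proof -
  have "net_dist N (edge_clamp e x) (edge_clamp e y) \<le> \<bar>max 0 (min x (len N e)) - max 0 (min y (len N e))\<bar>"
    using edge_clamp_in_locations[OF assms] unfolding edge_clamp_def by (intro net_dist_edge) auto
  then show ?thesis by linarith
qed

text \<open>On each clamped edge the function is Lipschitz on the reals, hence Borel; the finitely
  many edges are glued along the measurable choice \<open>fst\<close>.\<close>

lemma measurable_net_lipschitz:
  assumes "net_lipschitz L \<phi>" shows "\<phi> \<in> borel_measurable (location_algebra N)"
proof -
  have "(\<lambda>p. \<phi> (edge_clamp (fst p) (snd p))) \<in> borel_measurable (location_algebra N)"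
  proof (rule measurable_compose_countable'[where f = "\<lambda>e p. \<phi> (edge_clamp e (snd p))"])
    fix e assume e: "e \<in> edges N"
    have "\<bar>L\<bar>-lipschitz_on UNIV (\<lambda>x. \<phi> (edge_clamp e x))"
    proof (rule lipschitz_onI)
      fix x y
      have "\<bar>\<phi> (edge_clamp e x) - \<phi> (edge_clamp e y)\<bar> \<le> L * net_dist N (edge_clamp e x) (edge_clamp e y)"
        by (intro net_lipschitz_abs[OF assms] edge_clamp_in_locations e)
      also have "\<dots> \<le> \<bar>L\<bar> * \<bar>x - y\<bar>"
        using net_dist_clamp[OF e] net_dist_nonneg[OF edge_clamp_in_locations edge_clamp_in_locations, OF e e]
        by (intro mult_mono) auto
      finally show "dist (\<phi> (edge_clamp e x)) (\<phi> (edge_clamp e y)) \<le> \<bar>L\<bar> * dist x y"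
        by (simp add: dist_real_def)
    qed simp
    then have "(\<lambda>x. \<phi> (edge_clamp e x)) \<in> borel_measurable borel"
      by (intro borel_measurable_continuous_onI lipschitz_on_continuous_on)
    then show "(\<lambda>p. \<phi> (edge_clamp e (snd p))) \<in> borel_measurable (location_algebra N)"
      by (rule measurable_compose[OF measurable_snd_location])
  qed (use measurable_fst_location finite_edges in \<open>auto intro: countable_finite\<close>)
  then show ?thesis
    by (subst measurable_cong[where g = "\<lambda>p. \<phi> (edge_clamp (fst p) (snd p))"])
      (auto simp: space_location_algebra edge_clamp_location)
qed

text \<open>The gluing argument on pairs of edges. Joint measurability is required since both end
  points of a matched pair are random. The Lipschitz constant 2 bounds each coordinate difference by
  the Euclidean distance.\<close>

lemma measurable_net_dist:
  "(\<lambda>z. net_dist N (fst z) (snd z)) \<in> borel_measurable (location_algebra N \<Otimes>\<^sub>M location_algebra N)"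
proof -
  let ?M = "location_algebra N"
  note [measurable] = measurable_snd_location measurable_fst_location
  define D where "D e z = net_dist N (edge_clamp (fst e) (fst z)) (edge_clamp (snd e) (snd z))" for e z
  have cont: "D e \<in> borel_measurable borel" if e: "e \<in> edges N \<times> edges N" for e
  proof -
    have "2-lipschitz_on UNIV (D e)"
    proof (rule lipschitz_onI)
      fix z w :: "real \<times> real"
      let ?z1 = "edge_clamp (fst e) (fst z)" and ?z2 = "edge_clamp (snd e) (snd z)"
        and ?w1 = "edge_clamp (fst e) (fst w)" and ?w2 = "edge_clamp (snd e) (snd w)"
      have loc: "?z1 \<in> locations N" "?z2 \<in> locations N" "?w1 \<in> locations N" "?w2 \<in> locations N"
        using e by (auto intro: edge_clamp_in_locations)
      have tri: "net_dist N a b \<le> net_dist N a a' + net_dist N a' b' + net_dist N b' b"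
        if "a \<in> locations N" "a' \<in> locations N" "b \<in> locations N" "b' \<in> locations N" for a a' b b'
        using net_dist_triangle[of a a' b] net_dist_triangle[of a' b' b] that by linarith
      have "\<bar>net_dist N ?z1 ?z2 - net_dist N ?w1 ?w2\<bar>
          \<le> net_dist N ?z1 ?w1 + net_dist N ?z2 ?w2"
        using tri[OF loc(1,3,2,4)] tri[OF loc(3,1,4,2)]
        by (simp add: net_dist_sym[of ?w1 ?z1] net_dist_sym[of ?w2 ?z2])
      also have "\<dots> \<le> \<bar>fst z - fst w\<bar> + \<bar>snd z - snd w\<bar>"
        using e by (intro add_mono net_dist_clamp) auto
      also have "\<dots> \<le> 2 * dist z w"
        using dist_fst_le[of z w] dist_snd_le[of z w] by (simp add: dist_real_def)
      finally show "dist (D e z) (D e w) \<le> 2 * dist z w" by (simp add: dist_real_def D_def)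
    qed simp
    then show ?thesis by (intro borel_measurable_continuous_onI lipschitz_on_continuous_on)
  qed
  have "(\<lambda>z. D (fst (fst z), fst (snd z)) (snd (fst z), snd (snd z))) \<in> borel_measurable (?M \<Otimes>\<^sub>M ?M)"
  proof (rule measurable_compose_countable'[where
        f = "\<lambda>e z. D e (snd (fst z), snd (snd z))" and I = "edges N \<times> edges N"])
    fix e assume e: "e \<in> edges N \<times> edges N"
    have "(\<lambda>z. (snd (fst z), snd (snd z))) \<in> (?M \<Otimes>\<^sub>M ?M) \<rightarrow>\<^sub>M borel"
      unfolding borel_prod[symmetric] by measurable
    then show "(\<lambda>z. D e (snd (fst z), snd (snd z))) \<in> borel_measurable (?M \<Otimes>\<^sub>M ?M)"
      by (rule measurable_compose) (rule cont[OF e])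
  next
    show "(\<lambda>z. (fst (fst z), fst (snd z))) \<in> ?M \<Otimes>\<^sub>M ?M \<rightarrow>\<^sub>M count_space (edges N \<times> edges N)"
      unfolding pair_measure_countable[OF countable_finite countable_finite, OF finite_edges finite_edges, symmetric]
      by measurable
  qed (use finite_edges in \<open>auto intro: countable_finite\<close>)
  then show ?thesis
    by (subst measurable_cong[where g = "\<lambda>z. D (fst (fst z), fst (snd z)) (snd (fst z), snd (snd z))"])
      (auto simp: space_location_algebra space_pair_measure edge_clamp_location D_def)
qed

lemma measurable_net_dist_point:
  "q \<in> locations N \<Longrightarrow> (\<lambda>p. net_dist N p q) \<in> borel_measurable (location_algebra N)"
  by (rule measurable_net_lipschitz[OF net_lipschitz_net_dist])

section \<open>Records of the same point\<close>

lemma mem_net_point: "q \<in> net_point N p \<longleftrightarrow> q \<in> locations N \<and> net_dist N q p = 0"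
  by (simp add: net_point_def net_dist_sym[of q])

lemma net_point_in_sets:
  assumes "q \<in> locations N" shows "net_point N q \<in> sets (location_algebra N)"
proof -
  have "net_point N q = {p \<in> space (location_algebra N). net_dist N p q = 0}"
    by (auto simp: mem_net_point space_location_algebra)
  then show ?thesis using measurable_net_dist_point[OF assms] by simp
qed

lemma net_point_eq:
  assumes "p \<in> locations N" "q \<in> net_point N p"
  shows "net_point N q = net_point N p"
proof -
  have q: "q \<in> locations N" "net_dist N q p = 0" using assms by (auto simp: mem_net_point)
  have "net_dist N s q = net_dist N s p" if "s \<in> locations N" for s
    using net_dist_triangle[OF that q(1) assms(1)] net_dist_triangle[OF that assms(1) q(1)]
      q(2) net_dist_sym[of q p] by simp
  then show ?thesis by (auto simp: mem_net_point)
qed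

lemma net_lipschitz_net_point:
  assumes "net_lipschitz L \<phi>" "p \<in> locations N" "q \<in> net_point N p"
  shows "\<phi> q = \<phi> p"
proof -
  have "\<bar>\<phi> q - \<phi> p\<bar> \<le> L * net_dist N q p"
    using assms by (intro net_lipschitz_abs) (auto simp: mem_net_point)
  then show ?thesis using assms by (simp add: mem_net_point)
qed

text \<open>Vanishing at both ends allows continuation by 0 across the nodes. Such bumps separate
  interior points from everything else and cut out the open intervals of an edge.\<close>

lemma net_lipschitz_bump:
  assumes "e \<in> edges N" "0 \<le> L" "h 0 = 0" "h (len N e) = 0"
    and "\<And>x y. \<bar>h x - h y\<bar> \<le> L * \<bar>x - y\<bar>"
  shows "net_lipschitz L (\<lambda>p. if fst p = e then h (snd p) else 0)"
  by (rule net_lipschitzI) (use assms in \<open>auto simp: located_at_def\<close>)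

text \<open>The only records that can share their network point with another record, as
  \<open>net_point_interior\<close> shows; there are finitely many.\<close>

definition node_records :: "('e \<times> real) set" where
  "node_records = (\<lambda>e. (e, 0)) ` edges N \<union> (\<lambda>e. (e, len N e)) ` edges N"

lemma finite_node_records: "finite node_records"
  unfolding node_records_def using finite_edges by auto

lemma node_records_locations: "node_records \<subseteq> locations N"
  unfolding node_records_def using start_in_locations end_in_locations by auto

text \<open>A tent on the edge with its peak at \<open>p\<close> attains its maximal value nowhere
  else, and Lipschitz functions are constant on network points.\<close>

lemma net_point_interior:
  assumes p: "p \<in> locations N" "p \<notin> node_records"
  shows "net_point N p = {p}"
proof -
  define e x where "e = fst p" and "x = snd p"
  have e: "e \<in> edges N" and x: "0 < x" "x < len N e"
    using p by (auto simp: mem_locations node_records_def e_def x_def image_iff prod_eq_iff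
        order_less_le)
  define d where "d = min x (len N e - x)"
  define \<phi> where "\<phi> q = (if fst q = e then max 0 (d - \<bar>snd q - x\<bar>) else 0)" for q :: "'e \<times> real"
  have "\<bar>max 0 (d - \<bar>y - x\<bar>) - max 0 (d - \<bar>z - x\<bar>)\<bar> \<le> 1 * \<bar>y - z\<bar>" for y z
    by (auto simp: max_def abs_if)
  then have lip: "net_lipschitz 1 \<phi>"
    unfolding \<phi>_def using e x
    by (intro net_lipschitz_bump[where h = "\<lambda>y. max 0 (d - \<bar>y - x\<bar>)"]) (auto simp: d_def)
  have "q = p" if "q \<in> net_point N p" for q
  proof -
    have "\<phi> q = \<phi> p" by (rule net_lipschitz_net_point[OF lip p(1) that])
    moreover have "\<phi> p = d" "0 < d" using x by (auto simp: \<phi>_def e_def x_def d_def)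
    ultimately have "fst q = e" "snd q = x" by (auto simp: \<phi>_def split: if_splits)
    then show ?thesis by (simp add: e_def x_def prod_eq_iff)
  qed
  moreover have "p \<in> net_point N p" using p(1) by (simp add: mem_net_point net_dist_refl)
  ultimately show ?thesis by auto
qed

text \<open>Equal distributions on the network may give different masses to the records of one node.
  Replacing every sample point by a representative record makes the expected imbalances vanish
  without changing any distance.\<close>

definition rep :: "'e \<times> real \<Rightarrow> 'e \<times> real" where
  "rep p = (SOME q. q \<in> net_point N p)"

lemma rep_in_net_point: "p \<in> locations N \<Longrightarrow> rep p \<in> net_point N p"
  unfolding rep_def by (rule someI[of _ p]) (simp add: mem_net_point net_dist_refl)

lemma rep_in_locations: "p \<in> locations N \<Longrightarrow> rep p \<in> locations N"
  using rep_in_net_point by (simp add: mem_net_point)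

lemma rep_eq: "p \<in> locations N \<Longrightarrow> q \<in> net_point N p \<Longrightarrow> rep q = rep p"
  unfolding rep_def by (simp add: net_point_eq)

lemma rep_interior: "p \<in> locations N \<Longrightarrow> p \<notin> node_records \<Longrightarrow> rep p = p"
  using rep_in_net_point net_point_interior by blast

text \<open>Away from the finitely many node records \<open>rep\<close> is the identity, and whole
  network points are mapped to one record. A preimage therefore differs from \<open>S\<close> only
  by finitely many measurable pieces, which makes \<open>rep\<close> measurable.\<close>

lemma rep_vimage:
  "rep -` S \<inter> locations N = (S \<inter> locations N - node_records)
    \<union> (\<Union>q\<in>{q \<in> node_records. rep q \<in> S}. net_point N q)" (is "?A = ?B")
proof (intro set_eqI iffI)
  fix p assume "p \<in> ?A"
  then have p: "rep p \<in> S" "p \<in> locations N" by auto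
  have "p \<in> net_point N p" using p(2) by (simp add: mem_net_point net_dist_refl)
  then show "p \<in> ?B" using rep_interior[OF p(2)] p by (cases "p \<in> node_records") (blast, simp)
next
  fix p assume "p \<in> ?B"
  then consider "p \<in> S" "p \<in> locations N" "p \<notin> node_records"
    | q where "q \<in> node_records" "rep q \<in> S" "p \<in> net_point N q" by blast
  then show "p \<in> ?A"
  proof cases
    case 1
    then show ?thesis using rep_interior by simp
  next
    case 2
    then have "rep p = rep q" "p \<in> locations N"
      using rep_eq[of q p] node_records_locations by (auto simp: mem_net_point)
    then show ?thesis using 2 by simp
  qed
qed

lemma singleton_in_sets:
  assumes "p \<in> locations N" shows "{p} \<in> sets (location_algebra N)"
proof -
  have "{p} = (snd -` {snd p} \<inter> space (location_algebra N)) \<inter> {q \<in> locations N. fst q = fst p}"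
    using assms by (auto simp: space_location_algebra prod_eq_iff)
  also have "\<dots> \<in> sets (location_algebra N)"
    by (intro sets.Int measurable_sets[OF measurable_snd_location] edge_in_sets) simp
  finally show ?thesis .
qed

lemma node_records_in_sets: "node_records \<in> sets (location_algebra N)"
proof -
  have "(\<Union>p\<in>node_records. {p}) \<in> sets (location_algebra N)"
    using finite_node_records singleton_in_sets node_records_locations
    by (intro sets.finite_UN) auto
  then show ?thesis by simp
qed

lemma measurable_rep: "rep \<in> measurable (location_algebra N) (location_algebra N)"
proof (rule measurable_sigma_sets[OF sets_location_algebra generators_subset])
  let ?M = "location_algebra N"
  show "rep \<in> space ?M \<rightarrow> locations N"
    using rep_in_locations by (simp add: space_location_algebra)
  fix S assume "S \<in> {segment e x | e x. e \<in> edges N \<and> 0 \<le> x \<and> x \<le> len N e}"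
  then have S: "S \<in> sets ?M" by (auto simp: sets_location_algebra)
  have "S \<inter> locations N - node_records \<in> sets ?M"
    using S node_records_in_sets sets.top[of ?M] by (auto simp: space_location_algebra)
  then show "rep -` S \<inter> space ?M \<in> sets ?M"
    unfolding space_location_algebra rep_vimage
    using finite_node_records net_point_in_sets node_records_locations
    by (intro sets.Un sets.finite_UN) auto
qed

section \<open>Lipschitz functions determine the distribution\<close>

text \<open>The definition does not fix the sign of \<open>L\<close>; a positive constant is wanted
  where one divides by it. Enlarging to \<open>\<bar>L\<bar> + 1\<close> is possible since distances
  are nonnegative.\<close>

lemma net_lipschitz_pos_const:
  assumes "net_lipschitz L \<phi>" obtains K where "0 < K" "net_lipschitz K \<phi>"
proof
  show "net_lipschitz (\<bar>L\<bar> + 1) \<phi>"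
    unfolding net_lipschitz_def
  proof (intro ballI)
    fix p q assume pq: "p \<in> locations N" "q \<in> locations N"
    have "\<phi> p - \<phi> q \<le> L * net_dist N p q" by (rule net_lipschitzD[OF assms pq])
    also have "\<dots> \<le> (\<bar>L\<bar> + 1) * net_dist N p q"
      using net_dist_nonneg[OF pq] by (intro mult_right_mono) auto
    finally show "\<phi> p - \<phi> q \<le> (\<bar>L\<bar> + 1) * net_dist N p q" .
  qed
qed simp

lemma net_lipschitz_add:
  "net_lipschitz K \<phi> \<Longrightarrow> net_lipschitz L \<psi> \<Longrightarrow> net_lipschitz (K + L) (\<lambda>p. \<phi> p + \<psi> p)"
  unfolding net_lipschitz_def by (fastforce simp: distrib_right)

lemma net_lipschitz_uminus: "net_lipschitz L \<phi> \<Longrightarrow> net_lipschitz L (\<lambda>p. - \<phi> p)"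
  unfolding net_lipschitz_def by (metis net_dist_sym minus_diff_minus minus_diff_eq)

text \<open>For nonnegative \<open>\<phi>\<close> these functions decrease to the indicator of the
  zero set of \<open>\<phi>\<close> as \<open>k\<close> grows. They carry equality of Lipschitz
  means over to the measures of zero sets.\<close>

lemma net_lipschitz_cutoff:
  assumes "net_lipschitz L \<phi>" "0 \<le> k"
  shows "net_lipschitz (k * L) (\<lambda>p. max 0 (1 - k * \<phi> p))"
  unfolding net_lipschitz_def
proof (intro ballI)
  fix p q assume pq: "p \<in> locations N" "q \<in> locations N"
  have le: "k * \<phi> q - k * \<phi> p \<le> k * (L * net_dist N p q)"
    using net_lipschitzD[OF assms(1) pq(2,1)] assms(2) net_dist_sym[of p q]
    by (metis mult_left_mono right_diff_distrib)
  have "0 \<le> L * net_dist N p q" using net_lipschitz_abs[OF assms(1) pq] by linarith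
  then have "0 \<le> k * (L * net_dist N p q)" using assms(2) by simp
  then show "max 0 (1 - k * \<phi> p) - max 0 (1 - k * \<phi> q) \<le> k * L * net_dist N p q"
    using le unfolding mult.assoc by linarith
qed

text \<open>A pi-system in the role of the closed sets. Nonnegativity of the functions makes the
  intersection of two zero sets the zero set of the sum.\<close>

definition zero_sets :: "('e \<times> real) set set" where
  "zero_sets = {{p \<in> locations N. f p = 0} | f. (\<exists>L. net_lipschitz L f) \<and> (\<forall>p. 0 \<le> f p)}"

lemma zero_setsI: "net_lipschitz L f \<Longrightarrow> (\<And>p. 0 \<le> f p) \<Longrightarrow> {p \<in> locations N. f p = 0} \<in> zero_sets"
  unfolding zero_sets_def by auto

lemma zero_sets_subset: "zero_sets \<subseteq> Pow (locations N)"
  unfolding zero_sets_def by auto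

lemma zero_sets_sets: "zero_sets \<subseteq> sets (location_algebra N)"
proof
  fix A assume "A \<in> zero_sets"
  then obtain f L where f: "net_lipschitz L f" and A: "A = {p \<in> locations N. f p = 0}"
    unfolding zero_sets_def by auto
  show "A \<in> sets (location_algebra N)"
    using measurable_sets[OF measurable_net_lipschitz[OF f], of "{0}"]
    by (simp add: A space_location_algebra vimage_def Int_def conj_commute)
qed

lemma Int_stable_zero_sets: "Int_stable zero_sets"
proof (rule Int_stableI)
  fix A B assume "A \<in> zero_sets" "B \<in> zero_sets"
  then obtain f g K L where f: "net_lipschitz K f" "\<And>p. 0 \<le> f p" "A = {p \<in> locations N. f p = 0}"
    and g: "net_lipschitz L g" "\<And>p. 0 \<le> g p" "B = {p \<in> locations N. g p = 0}"
    unfolding zero_sets_def by auto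
  have "A \<inter> B = {p \<in> locations N. f p + g p = 0}"
    unfolding f(3) g(3) using f(2) g(2) by (auto simp: add_nonneg_eq_0_iff)
  then show "A \<inter> B \<in> zero_sets"
    using zero_setsI[OF net_lipschitz_add[OF f(1) g(1)]] f(2) g(2) by simp
qed

lemma cutoff_integral_tendsto:
  assumes "prob_space \<kappa>" and sets: "sets \<kappa> = sets (location_algebra N)"
    and f: "net_lipschitz L f" "\<And>p. 0 \<le> f p"
  shows "(\<lambda>k. \<integral>p. max 0 (1 - real k * f p) \<partial>\<kappa>) \<longlonglongrightarrow> measure \<kappa> {p \<in> locations N. f p = 0}"
proof -
  interpret prob_space \<kappa> by fact
  have space: "space \<kappa> = locations N"
    using sets_eq_imp_space_eq[OF sets] by (simp add: space_location_algebra)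
  have [measurable]: "f \<in> borel_measurable \<kappa>"
    using measurable_net_lipschitz[OF f(1)] by (simp cong: measurable_cong_sets add: sets)
  have "(\<lambda>k. \<integral>p. max 0 (1 - real k * f p) \<partial>\<kappa>) \<longlonglongrightarrow> (\<integral>p. indicator {p. f p = 0} p \<partial>\<kappa>)"
  proof (rule integral_dominated_convergence[where w = "\<lambda>_. 1"])
    show "AE p in \<kappa>. (\<lambda>k. max 0 (1 - real k * f p)) \<longlonglongrightarrow> indicator {p. f p = 0} p"
    proof (rule AE_I2)
      fix p
      show "(\<lambda>k. max 0 (1 - real k * f p)) \<longlonglongrightarrow> indicator {p. f p = 0} p"
      proof (cases "f p = 0")
        case False
        then have pos: "0 < f p" using f(2)[of p] by simp
        obtain m :: nat where "1 / f p < real m" using reals_Archimedean2 by blast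
        then have m: "1 \<le> real k * f p" if "m \<le> k" for k
          using pos that by (simp add: divide_less_eq) (smt (verit) mult_right_mono of_nat_mono)
        have "eventually (\<lambda>k. max 0 (1 - real k * f p) = 0) sequentially"
          using eventually_ge_at_top[of m] by eventually_elim (use m in \<open>simp add: max_absorb1\<close>)
        then show ?thesis using False by (simp add: tendsto_eventually)
      qed simp
    qed
    show "AE p in \<kappa>. norm (max 0 (1 - real k * f p)) \<le> 1" for k
      using f(2) by auto
  qed auto
  also have "(\<integral>p. indicator {p. f p = 0} p \<partial>\<kappa>) = measure \<kappa> {p \<in> locations N. f p = 0}"
    by (simp add: space Int_def conj_commute)
  finally show ?thesis .
qed

text \<open>A set containing all records of its points is its own preimage under \<open>rep\<close>,
  so it suffices that \<open>rep\<close> is measurable from the sigma-algebra of the zero sets to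
  the location algebra. By \<open>rep_vimage\<close> this needs only network points, which are zero
  sets of distance functions, and open intervals of edges, which are complements of zero sets of
  bumps.\<close>

lemma saturated_in_sigma_zero_sets:
  assumes A: "A \<in> sets (location_algebra N)" and sat: "\<And>p. p \<in> A \<Longrightarrow> net_point N p \<subseteq> A"
  shows "A \<in> sigma_sets (locations N) zero_sets"
proof -
  let ?S = "sigma (locations N) zero_sets"
  have sets_S: "sets ?S = sigma_sets (locations N) zero_sets" and space_S: "space ?S = locations N"
    using zero_sets_subset by auto
  have point: "net_point N q \<in> sets ?S" if "q \<in> locations N" for q
  proof -
    have "{p \<in> locations N. \<bar>net_dist N p q\<bar> = 0} \<in> zero_sets"
    proof (rule zero_setsI)
      show "net_lipschitz 1 (\<lambda>p. \<bar>net_dist N p q\<bar>)"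
        unfolding net_lipschitz_def
        using net_lipschitz_abs[OF net_lipschitz_net_dist[OF that]] by fastforce
    qed simp
    moreover have "net_point N q = {p \<in> locations N. \<bar>net_dist N p q\<bar> = 0}"
      by (auto simp: mem_net_point)
    ultimately show ?thesis unfolding sets_S by (simp add: sigma_sets.Basic)
  qed
  have interval: "{p \<in> locations N. fst p = e \<and> a < snd p \<and> snd p < b} \<in> sets ?S"
    if e: "e \<in> edges N" and ab: "0 \<le> a" "b \<le> len N e" for e a b
  proof -
    define h where "h x = max 0 (min (x - a) (b - x))" for x
    have h: "\<bar>h x - h y\<bar> \<le> 1 * \<bar>x - y\<bar>" for x y unfolding h_def by (auto simp: abs_if max_def min_def)
    have "h 0 = 0" "h (len N e) = 0" using ab by (auto simp: h_def)
    then have "net_lipschitz 1 (\<lambda>p. if fst p = e then h (snd p) else 0)"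
      by (intro net_lipschitz_bump[OF e] h) auto
    then have "{p \<in> locations N. (if fst p = e then h (snd p) else 0) = 0} \<in> zero_sets"
      by (rule zero_setsI) (simp add: h_def)
    then have "space ?S - {p \<in> locations N. (if fst p = e then h (snd p) else 0) = 0} \<in> sets ?S"
      by (intro sets.compl_sets) (simp add: sets_S sigma_sets.Basic)
    also have "space ?S - {p \<in> locations N. (if fst p = e then h (snd p) else 0) = 0}
        = {p \<in> locations N. fst p = e \<and> a < snd p \<and> snd p < b}"
      unfolding space_S by (auto simp: h_def max_def min_def split: if_splits)
    finally show ?thesis .
  qed
  have "rep \<in> measurable ?S (location_algebra N)"
  proof (rule measurable_sigma_sets[OF sets_location_algebra generators_subset])
    show "rep \<in> space ?S \<rightarrow> locations N" using rep_in_locations by (simp add: space_S)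
    fix S assume "S \<in> {segment e x | e x. e \<in> edges N \<and> 0 \<le> x \<and> x \<le> len N e}"
    then obtain e x where S: "S = segment e x" and e: "e \<in> edges N" and x: "0 \<le> x" "x \<le> len N e"
      by auto
    define I where "I a b = {p \<in> locations N. fst p = e \<and> a < snd p \<and> snd p < b}" for a b
    \<comment> \<open>The interior part of a segment is closed at its right end; it is obtained as a
      difference of two open intervals, the kind of set that bumps supply.\<close>
    have inner: "S \<inter> locations N - node_records = I 0 (len N e) - I x (len N e)"
    proof (rule set_eqI)
      fix p
      show "p \<in> S \<inter> locations N - node_records \<longleftrightarrow> p \<in> I 0 (len N e) - I x (len N e)"
      proof (cases "p \<in> locations N \<and> fst p = e")
        case True
        then have "p \<in> node_records \<longleftrightarrow> snd p = 0 \<or> snd p = len N e"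
          using e by (cases p) (auto simp: node_records_def)
        then show ?thesis using True x by (auto simp: S mem_segment I_def mem_locations)
      qed (auto simp: S mem_segment I_def)
    qed
    show "rep -` S \<inter> space ?S \<in> sets ?S"
      unfolding space_S rep_vimage inner unfolding I_def
      using interval[OF e] x finite_node_records point node_records_locations
      by (intro sets.Un sets.Diff sets.finite_UN) auto
  qed
  from measurable_sets[OF this A] have "rep -` A \<inter> locations N \<in> sets ?S" by (simp add: space_S)
  also have "rep -` A \<inter> locations N = A"
  proof (intro set_eqI iffI)
    fix p assume "p \<in> rep -` A \<inter> locations N"
    then have p: "rep p \<in> A" "p \<in> locations N" by auto
    then have "p \<in> net_point N (rep p)"
      using net_point_eq[OF p(2) rep_in_net_point[OF p(2)]]
      by (simp add: mem_net_point net_dist_refl)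
    then show "p \<in> A" using sat[OF p(1)] by blast
  next
    fix p assume p: "p \<in> A"
    then have loc: "p \<in> locations N"
      using sets.sets_into_space[OF A] by (auto simp: space_location_algebra)
    then show "p \<in> rep -` A \<inter> locations N" using rep_in_net_point[OF loc] sat[OF p] by auto
  qed
  finally show ?thesis by (simp add: sets_S)
qed

end

locale random_network = connected_net N + M1: prob_space \<mu> + M2: prob_space \<nu>
  for N :: "('v, 'e) network" and \<mu> \<nu> :: "('e \<times> real) measure" +
  assumes sets_\<mu> [measurable_cong]: "sets \<mu> = sets (location_algebra N)"
    and sets_\<nu> [measurable_cong]: "sets \<nu> = sets (location_algebra N)"
begin

lemma space_\<mu>: "space \<mu> = locations N" and space_\<nu>: "space \<nu> = locations N"
  using sets_eq_imp_space_eq[OF sets_\<mu>] sets_eq_imp_space_eq[OF sets_\<nu>]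
  by (simp_all add: space_location_algebra)

text \<open>By the pi-lambda theorem it suffices to compare zero sets, where the cutoffs have equal
  means and converge. Its contrapositive provides the Lipschitz function behind the linear lower
  bound.\<close>

lemma same_distributionI:
  assumes eq: "\<And>\<phi> L. net_lipschitz L \<phi> \<Longrightarrow> (\<integral>p. \<phi> p \<partial>\<mu>) = (\<integral>p. \<phi> p \<partial>\<nu>)"
  shows "same_distribution N \<mu> \<nu>"
  unfolding same_distribution_def
proof (intro ballI impI)
  fix A assume A: "A \<in> sets (location_algebra N)" and sat: "\<forall>p\<in>A. net_point N p \<subseteq> A"
  have sub: "sigma_sets (locations N) zero_sets \<subseteq> sets (location_algebra N)"
    using sets.sigma_sets_subset[OF zero_sets_sets] by (simp add: space_location_algebra)
  have "A \<in> sigma_sets (locations N) zero_sets" using saturated_in_sigma_zero_sets[OF A] sat by blast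
  with Int_stable_zero_sets zero_sets_subset show "measure \<mu> A = measure \<nu> A"
  proof (induction rule: sigma_sets_induct_disjoint)
    case (basic A)
    then obtain f L where f: "net_lipschitz L f" "\<And>p. 0 \<le> f p" and A: "A = {p \<in> locations N. f p = 0}"
      unfolding zero_sets_def by auto
    have "(\<integral>p. max 0 (1 - real k * f p) \<partial>\<mu>) = (\<integral>p. max 0 (1 - real k * f p) \<partial>\<nu>)" for k
      using net_lipschitz_cutoff[OF f(1), of "real k"] by (intro eq) auto
    then show ?case
      using cutoff_integral_tendsto[OF M1.prob_space_axioms sets_\<mu> f]
        cutoff_integral_tendsto[OF M2.prob_space_axioms sets_\<nu> f] LIMSEQ_unique
      unfolding A by auto
  next
    case (compl A)
    then show ?case
      using sub M1.prob_compl[of A] M2.prob_compl[of A] by (auto simp: sets_\<mu> sets_\<nu> space_\<mu> space_\<nu>)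
  next
    case (union A)
    then have A: "range A \<subseteq> sets (location_algebra N)" using sub by blast
    show ?case
      using M1.finite_measure_UNION[OF _ union(1)] M2.finite_measure_UNION[OF _ union(1)] A union(3)
      by (simp add: sets_\<mu> sets_\<nu>) (metis sums_unique2)
  qed simp
qed

section \<open>Expected matching distance\<close>

abbreviation samples :: "nat \<Rightarrow> ((nat \<Rightarrow> 'e \<times> real) \<times> (nat \<Rightarrow> 'e \<times> real)) measure" where
  "samples n \<equiv> (\<Pi>\<^sub>M i\<in>{..<n}. \<mu>) \<Otimes>\<^sub>M (\<Pi>\<^sub>M i\<in>{..<n}. \<nu>)"

lemma prob_space_samples: "prob_space (samples n)"
  by (intro prob_space_pair prob_space_PiM M1.prob_space_axioms M2.prob_space_axioms)

lemma sample_in_locations: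
  assumes "\<omega> \<in> space (samples n)" "i < n"
  shows "fst \<omega> i \<in> locations N" "snd \<omega> i \<in> locations N"
  using assms by (auto simp: space_pair_measure space_PiM PiE_def Pi_def space_\<mu> space_\<nu>)

lemma measurable_sample:
  assumes "i < n"
  shows "(\<lambda>\<omega>. fst \<omega> i) \<in> samples n \<rightarrow>\<^sub>M \<mu>" "(\<lambda>\<omega>. snd \<omega> i) \<in> samples n \<rightarrow>\<^sub>M \<nu>"
  using assms by (auto intro: measurable_compose[OF measurable_fst] measurable_compose[OF measurable_snd]
      measurable_component_singleton)

lemma measurable_min_matching:
  "(\<lambda>\<omega>. min_matching_dist N n (fst \<omega>) (snd \<omega>)) \<in> borel_measurable (samples n)"
  unfolding min_matching_dist_def
proof (intro borel_measurable_Min borel_measurable_sum)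
  show "finite {\<sigma>. \<sigma> permutes {..<n}}" by (simp add: finite_permutations)
  fix \<sigma> i assume "\<sigma> \<in> {\<sigma>. \<sigma> permutes {..<n}}" "i \<in> {..<n}"
  then have i: "i < n" "\<sigma> i < n" using permutes_in_image[of \<sigma> "{..<n}" i] by auto
  have "(\<lambda>\<omega>. (fst \<omega> i, snd \<omega> (\<sigma> i))) \<in> samples n \<rightarrow>\<^sub>M (location_algebra N \<Otimes>\<^sub>M location_algebra N)"
    using measurable_sample(1)[OF i(1)] measurable_sample(2)[OF i(2)]
    by (intro measurable_Pair) (simp_all cong: measurable_cong_sets add: sets_\<mu> sets_\<nu>)
  from measurable_compose[OF this measurable_net_dist]
  show "(\<lambda>\<omega>. net_dist N (fst \<omega> i) (snd \<omega> (\<sigma> i))) \<in> borel_measurable (samples n)" by simp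
qed

lemma expected_Z_CF_eq:
  "expected_Z_CF N \<mu> \<nu> n = (\<integral>\<omega>. min_matching_dist N n (fst \<omega>) (snd \<omega>) \<partial>samples n)"
  unfolding expected_Z_CF_def
  by (intro Bochner_Integration.integral_cong refl Z_CF_eq_min_matching_dist sample_in_locations)

lemma min_matching_bounds:
  "\<exists>D. \<forall>n. \<forall>\<omega>\<in>space (samples n). 0 \<le> min_matching_dist N n (fst \<omega>) (snd \<omega>) \<and>
      min_matching_dist N n (fst \<omega>) (snd \<omega>) \<le> real n * D"
proof -
  obtain D where D: "0 \<le> D" "\<And>p q. p \<in> locations N \<Longrightarrow> q \<in> locations N \<Longrightarrow> net_dist N p q \<le> D"
    using net_dist_bounded by blast
  have "0 \<le> min_matching_dist N n (fst \<omega>) (snd \<omega>) \<and>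
      min_matching_dist N n (fst \<omega>) (snd \<omega>) \<le> real n * D" if \<omega>: "\<omega> \<in> space (samples n)" for n \<omega>
  proof
    obtain \<sigma> where \<sigma>: "\<sigma> permutes {..<n}" "min_matching_dist N n (fst \<omega>) (snd \<omega>)
        = (\<Sum>i<n. net_dist N (fst \<omega> i) (snd \<omega> (\<sigma> i)))"
      by (rule min_matching_attained)
    have loc: "fst \<omega> i \<in> locations N" "snd \<omega> (\<sigma> i) \<in> locations N" if "i < n" for i
      using sample_in_locations[OF \<omega>] permutes_in_image[OF \<sigma>(1), of i] that by auto
    show "0 \<le> min_matching_dist N n (fst \<omega>) (snd \<omega>)"
      unfolding \<sigma>(2) by (intro sum_nonneg net_dist_nonneg loc) auto
    have "(\<Sum>i<n. net_dist N (fst \<omega> i) (snd \<omega> (\<sigma> i))) \<le> (\<Sum>i<n. D)"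
      by (intro sum_mono D(2) loc) auto
    then show "min_matching_dist N n (fst \<omega>) (snd \<omega>) \<le> real n * D" unfolding \<sigma>(2) by simp
  qed
  then show ?thesis by blast
qed

lemma integrable_min_matching:
  "integrable (samples n) (\<lambda>\<omega>. min_matching_dist N n (fst \<omega>) (snd \<omega>))"
proof -
  interpret S: prob_space "samples n" by (rule prob_space_samples)
  obtain D where D: "\<forall>n. \<forall>\<omega>\<in>space (samples n). 0 \<le> min_matching_dist N n (fst \<omega>) (snd \<omega>) \<and>
      min_matching_dist N n (fst \<omega>) (snd \<omega>) \<le> real n * D"
    using min_matching_bounds by blast
  show ?thesis
  proof (rule S.integrable_const_bound[OF AE_I2 measurable_min_matching])
    fix \<omega> assume "\<omega> \<in> space (samples n)"
    with D have "0 \<le> min_matching_dist N n (fst \<omega>) (snd \<omega>) \<and>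
      min_matching_dist N n (fst \<omega>) (snd \<omega>) \<le> real n * D" by blast
    then show "norm (min_matching_dist N n (fst \<omega>) (snd \<omega>)) \<le> real n * D" by simp
  qed
qed

lemma expected_Z_CF_nonneg: "0 \<le> expected_Z_CF N \<mu> \<nu> n"
  unfolding expected_Z_CF_eq
  by (rule integral_nonneg_AE, rule AE_I2) (use min_matching_bounds in blast)

lemma expected_Z_CF_linear_upper: "\<exists>C. \<forall>n. expected_Z_CF N \<mu> \<nu> n \<le> C * real n"
proof -
  obtain D where D: "\<forall>n. \<forall>\<omega>\<in>space (samples n). 0 \<le> min_matching_dist N n (fst \<omega>) (snd \<omega>) \<and>
      min_matching_dist N n (fst \<omega>) (snd \<omega>) \<le> real n * D"
    using min_matching_bounds by blast
  have "expected_Z_CF N \<mu> \<nu> n \<le> D * real n" for n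
  proof -
    interpret S: prob_space "samples n" by (rule prob_space_samples)
    have "expected_Z_CF N \<mu> \<nu> n \<le> (\<integral>\<omega>. real n * D \<partial>samples n)"
      unfolding expected_Z_CF_eq
      by (rule integral_mono[OF integrable_min_matching]) (use D in auto)
    then show ?thesis by (simp add: S.prob_space mult.commute)
  qed
  then show ?thesis by blast
qed

lemma distr_samples:
  "distr (samples n) (\<Pi>\<^sub>M i\<in>{..<n}. \<mu>) fst = (\<Pi>\<^sub>M i\<in>{..<n}. \<mu>)"
  "distr (samples n) (\<Pi>\<^sub>M i\<in>{..<n}. \<nu>) snd = (\<Pi>\<^sub>M i\<in>{..<n}. \<nu>)"
proof -
  interpret U: prob_space "\<Pi>\<^sub>M i\<in>{..<n}. \<mu>" by (intro prob_space_PiM M1.prob_space_axioms)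
  interpret V: prob_space "\<Pi>\<^sub>M i\<in>{..<n}. \<nu>" by (intro prob_space_PiM M2.prob_space_axioms)
  interpret UV: pair_sigma_finite "\<Pi>\<^sub>M i\<in>{..<n}. \<mu>" "\<Pi>\<^sub>M i\<in>{..<n}. \<nu>" ..
  show "distr (samples n) (\<Pi>\<^sub>M i\<in>{..<n}. \<mu>) fst = (\<Pi>\<^sub>M i\<in>{..<n}. \<mu>)" by (rule V.distr_pair_fst)
  show "distr (samples n) (\<Pi>\<^sub>M i\<in>{..<n}. \<nu>) snd = (\<Pi>\<^sub>M i\<in>{..<n}. \<nu>)"
    by (subst UV.distr_pair_swap, subst distr_distr)
      (auto simp: comp_def case_prod_beta U.distr_pair_fst)
qed

lemma distr_sample:
  assumes "i < n"
  shows "distr (samples n) \<mu> (\<lambda>\<omega>. fst \<omega> i) = \<mu>" "distr (samples n) \<nu> (\<lambda>\<omega>. snd \<omega> i) = \<nu>"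
proof -
  have "distr (samples n) \<mu> (\<lambda>\<omega>. fst \<omega> i) = distr (distr (samples n) (\<Pi>\<^sub>M i\<in>{..<n}. \<mu>) fst) \<mu> (\<lambda>u. u i)"
    using assms by (subst distr_distr) (auto simp: comp_def)
  then show "distr (samples n) \<mu> (\<lambda>\<omega>. fst \<omega> i) = \<mu>"
    using assms distr_PiM_component[of "{..<n}" "\<lambda>_. \<mu>" i] M1.prob_space_axioms
    by (simp add: distr_samples)
  have "distr (samples n) \<nu> (\<lambda>\<omega>. snd \<omega> i) = distr (distr (samples n) (\<Pi>\<^sub>M i\<in>{..<n}. \<nu>) snd) \<nu> (\<lambda>u. u i)"
    using assms by (subst distr_distr) (auto simp: comp_def)
  then show "distr (samples n) \<nu> (\<lambda>\<omega>. snd \<omega> i) = \<nu>"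
    using assms distr_PiM_component[of "{..<n}" "\<lambda>_. \<nu>" i] M2.prob_space_axioms
    by (simp add: distr_samples)
qed

section \<open>Means of Lipschitz functions and the linear lower bound\<close>

lemma net_lipschitz_bounded:
  assumes "net_lipschitz L \<phi>"
  obtains B where "\<And>p. p \<in> locations N \<Longrightarrow> \<bar>\<phi> p\<bar> \<le> B"
proof -
  obtain D where D: "0 \<le> D" "\<And>p q. p \<in> locations N \<Longrightarrow> q \<in> locations N \<Longrightarrow> net_dist N p q \<le> D"
    using net_dist_bounded by blast
  obtain K where K: "0 < K" "net_lipschitz K \<phi>" by (rule net_lipschitz_pos_const[OF assms])
  obtain q where q: "q \<in> locations N" using M1.not_empty by (auto simp: space_\<mu>)
  have "\<bar>\<phi> p\<bar> \<le> \<bar>\<phi> q\<bar> + K * D" if p: "p \<in> locations N" for p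
  proof -
    have "\<bar>\<phi> p - \<phi> q\<bar> \<le> K * D"
      using net_lipschitz_abs[OF K(2) p q] mult_left_mono[OF D(2)[OF p q], of K] K(1) by linarith
    then show ?thesis by linarith
  qed
  then show thesis by (rule that)
qed

lemma expectation_lipschitz:
  assumes \<phi>: "net_lipschitz L \<phi>" and i: "i < n"
  shows "integrable (samples n) (\<lambda>\<omega>. \<phi> (fst \<omega> i))" "(\<integral>\<omega>. \<phi> (fst \<omega> i) \<partial>samples n) = (\<integral>p. \<phi> p \<partial>\<mu>)"
    "integrable (samples n) (\<lambda>\<omega>. \<phi> (snd \<omega> i))" "(\<integral>\<omega>. \<phi> (snd \<omega> i) \<partial>samples n) = (\<integral>p. \<phi> p \<partial>\<nu>)"
proof -
  interpret S: prob_space "samples n" by (rule prob_space_samples)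
  have meas: "\<phi> \<in> borel_measurable \<mu>" "\<phi> \<in> borel_measurable \<nu>"
    using measurable_net_lipschitz[OF \<phi>] by (simp_all cong: measurable_cong_sets add: sets_\<mu> sets_\<nu>)
  obtain B where B: "\<And>p. p \<in> locations N \<Longrightarrow> \<bar>\<phi> p\<bar> \<le> B" using net_lipschitz_bounded[OF \<phi>] by blast
  show "integrable (samples n) (\<lambda>\<omega>. \<phi> (fst \<omega> i))"
    by (rule S.integrable_const_bound[where B = B, OF AE_I2 measurable_compose[OF measurable_sample(1)[OF i] meas(1)]])
      (simp add: B sample_in_locations(1)[OF _ i])
  show "integrable (samples n) (\<lambda>\<omega>. \<phi> (snd \<omega> i))"
    by (rule S.integrable_const_bound[where B = B, OF AE_I2 measurable_compose[OF measurable_sample(2)[OF i] meas(2)]])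
      (simp add: B sample_in_locations(2)[OF _ i])
  show "(\<integral>\<omega>. \<phi> (fst \<omega> i) \<partial>samples n) = (\<integral>p. \<phi> p \<partial>\<mu>)"
    using integral_distr[OF measurable_sample(1)[OF i] meas(1)] by (simp add: distr_sample[OF i])
  show "(\<integral>\<omega>. \<phi> (snd \<omega> i) \<partial>samples n) = (\<integral>p. \<phi> p \<partial>\<nu>)"
    using integral_distr[OF measurable_sample(2)[OF i] meas(2)] by (simp add: distr_sample[OF i])
qed

text \<open>Weak duality in expectation: by linearity each index contributes the difference of the
  two means.\<close>

lemma lipschitz_lower_bound:
  assumes "net_lipschitz L \<phi>"
  shows "real n * ((\<integral>p. \<phi> p \<partial>\<mu>) - (\<integral>p. \<phi> p \<partial>\<nu>)) \<le> L * expected_Z_CF N \<mu> \<nu> n"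
proof -
  note e = expectation_lipschitz[OF assms, where n = n]
  have sums: "integrable (samples n) (\<lambda>\<omega>. \<Sum>i<n. \<phi> (fst \<omega> i))"
    "integrable (samples n) (\<lambda>\<omega>. \<Sum>i<n. \<phi> (snd \<omega> i))"
    using e(1,3) by (auto intro: Bochner_Integration.integrable_sum)
  have "real n * ((\<integral>p. \<phi> p \<partial>\<mu>) - (\<integral>p. \<phi> p \<partial>\<nu>))
    = (\<Sum>i<n. \<integral>\<omega>. \<phi> (fst \<omega> i) \<partial>samples n) - (\<Sum>i<n. \<integral>\<omega>. \<phi> (snd \<omega> i) \<partial>samples n)"
    using e(2,4) by (simp add: right_diff_distrib)
  also have "(\<Sum>i<n. \<integral>\<omega>. \<phi> (fst \<omega> i) \<partial>samples n) = (\<integral>\<omega>. (\<Sum>i<n. \<phi> (fst \<omega> i)) \<partial>samples n)"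
    by (rule Bochner_Integration.integral_sum[symmetric]) (use e(1) in auto)
  also have "(\<Sum>i<n. \<integral>\<omega>. \<phi> (snd \<omega> i) \<partial>samples n) = (\<integral>\<omega>. (\<Sum>i<n. \<phi> (snd \<omega> i)) \<partial>samples n)"
    by (rule Bochner_Integration.integral_sum[symmetric]) (use e(3) in auto)
  also have "(\<integral>\<omega>. (\<Sum>i<n. \<phi> (fst \<omega> i)) \<partial>samples n) - (\<integral>\<omega>. (\<Sum>i<n. \<phi> (snd \<omega> i)) \<partial>samples n)
      = (\<integral>\<omega>. (\<Sum>i<n. \<phi> (fst \<omega> i)) - (\<Sum>i<n. \<phi> (snd \<omega> i)) \<partial>samples n)"
    by (rule Bochner_Integration.integral_diff[symmetric, OF sums])
  also have "\<dots> \<le> (\<integral>\<omega>. L * min_matching_dist N n (fst \<omega>) (snd \<omega>) \<partial>samples n)"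
    by (rule integral_mono[OF Bochner_Integration.integrable_diff[OF sums]
          integrable_mult_right[OF integrable_min_matching]])
      (rule lipschitz_le_min_matching[OF assms], auto intro: sample_in_locations)
  finally show ?thesis by (simp add: expected_Z_CF_eq)
qed

lemma expected_Z_CF_linear_lower:
  assumes "\<not> same_distribution N \<mu> \<nu>"
  shows "\<exists>c>0. \<forall>n. c * real n \<le> expected_Z_CF N \<mu> \<nu> n"
proof -
  obtain \<phi> L where \<phi>: "net_lipschitz L \<phi>" "(\<integral>p. \<phi> p \<partial>\<mu>) \<noteq> (\<integral>p. \<phi> p \<partial>\<nu>)"
    using same_distributionI assms by blast
  \<comment> \<open>Passing to the negative function, if necessary, makes the difference of the
    means positive.\<close>
  obtain \<psi> where \<psi>: "net_lipschitz L \<psi>" "(\<integral>p. \<psi> p \<partial>\<nu>) < (\<integral>p. \<psi> p \<partial>\<mu>)"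
  proof (cases "(\<integral>p. \<phi> p \<partial>\<nu>) < (\<integral>p. \<phi> p \<partial>\<mu>)")
    case True
    then show ?thesis using that \<phi>(1) by blast
  next
    case False
    then show ?thesis using that[OF net_lipschitz_uminus[OF \<phi>(1)]] \<phi>(2) by simp
  qed
  obtain K where K: "0 < K" "net_lipschitz K \<psi>" by (rule net_lipschitz_pos_const[OF \<psi>(1)])
  have "((\<integral>p. \<psi> p \<partial>\<mu>) - (\<integral>p. \<psi> p \<partial>\<nu>)) / K * real n \<le> expected_Z_CF N \<mu> \<nu> n" for n
    using lipschitz_lower_bound[OF K(2), of n] K(1) by (simp add: field_simps)
  then show ?thesis using \<psi>(2) K(1) by (intro exI[of _ "((\<integral>p. \<psi> p \<partial>\<mu>) - (\<integral>p. \<psi> p \<partial>\<nu>)) / K"]) auto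
qed

end

section \<open>Deviations of empirical counts\<close>

text \<open>Centred indicators of distinct coordinates are uncorrelated, so only the
  \<open>n\<close> diagonal terms, each at most 1, contribute to the second moment; the first
  absolute moment follows from it.\<close>

lemma (in prob_space) count_deviation:
  assumes B [measurable]: "B \<in> sets M"
  shows "integrable (\<Pi>\<^sub>M i\<in>{..<n}. M) (\<lambda>u. \<bar>(\<Sum>i<n. indicator B (u i)) - real n * prob B\<bar>)"
    and "(\<integral>u. \<bar>(\<Sum>i<n. indicator B (u i)) - real n * prob B\<bar> \<partial>(\<Pi>\<^sub>M i\<in>{..<n}. M)) \<le> sqrt (real n)"
proof -
  interpret P: prob_space "\<Pi>\<^sub>M i\<in>{..<n}. M" by (intro prob_space_PiM prob_space_axioms)
  interpret product_sigma_finite "\<lambda>_. M" ..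
  define g where "g x = indicator B x - prob B" for x
  have g [measurable]: "g \<in> borel_measurable M" unfolding g_def by measurable
  have g1: "\<bar>g x\<bar> \<le> 1" for x unfolding g_def by (auto simp: indicator_def)
  have g_int: "integrable M g" by (rule integrable_const_bound[where B = 1]) (auto intro: g1)
  have g0: "(\<integral>x. g x \<partial>M) = 0"
    unfolding g_def by (subst Bochner_Integration.integral_diff) (auto simp: prob_space integrable_real_indicator emeasure_eq_measure)
  define X where "X u = (\<Sum>i<n. g (u i))" for u
  have X_eq: "(\<Sum>i<n. indicator B (u i)) - real n * prob B = X u" for u
    by (simp add: X_def g_def sum_subtractf)
  have Xm [measurable]: "X \<in> borel_measurable (\<Pi>\<^sub>M i\<in>{..<n}. M)" unfolding X_def by measurable
  have Xb: "\<bar>X u\<bar> \<le> real n" for u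
  proof -
    have "\<bar>X u\<bar> \<le> (\<Sum>i<n. 1)" unfolding X_def by (rule order_trans[OF sum_abs sum_mono]) (rule g1)
    then show ?thesis by simp
  qed
  have int: "integrable (\<Pi>\<^sub>M i\<in>{..<n}. M) (\<lambda>u. \<bar>X u\<bar>)"
    by (rule P.integrable_const_bound[where B = "real n"]) (auto intro: Xb)
  then show "integrable (\<Pi>\<^sub>M i\<in>{..<n}. M) (\<lambda>u. \<bar>(\<Sum>i<n. indicator B (u i)) - real n * prob B\<bar>)"
    unfolding X_eq .
  have gi: "(\<lambda>u. g (u i)) \<in> borel_measurable (\<Pi>\<^sub>M i\<in>{..<n}. M)" if "i < n" for i
    using measurable_compose[OF measurable_component_singleton[of i "{..<n}" "\<lambda>_. M"] g] that by simp
  have gg_int: "integrable (\<Pi>\<^sub>M i\<in>{..<n}. M) (\<lambda>u. g (u i) * g (u j))" if "i < n" "j < n" for i j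
  proof (rule P.integrable_const_bound[where B = 1])
    show "AE u in \<Pi>\<^sub>M i\<in>{..<n}. M. norm (g (u i) * g (u j)) \<le> 1"
      using mult_mono[OF g1 g1] by (auto simp: abs_mult)
  qed (intro borel_measurable_times gi that)
  have gg: "(\<integral>u. g (u i) * g (u j) \<partial>(\<Pi>\<^sub>M i\<in>{..<n}. M)) \<le> of_bool (i = j)" if "i < n" "j < n" for i j
  proof (cases "i = j")
    case True
    have "(\<integral>u. g (u i) * g (u j) \<partial>(\<Pi>\<^sub>M i\<in>{..<n}. M)) \<le> (\<integral>u. 1 \<partial>(\<Pi>\<^sub>M i\<in>{..<n}. M))"
    proof (rule integral_mono[OF gg_int[OF that]])
      show "g (u i) * g (u j) \<le> 1" for u
        using mult_mono[OF g1[of "u i"] g1[of "u j"]] abs_ge_self[of "g (u i) * g (u j)"]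
        by (simp add: abs_mult)
    qed simp
    then show ?thesis using True by (simp add: P.prob_space)
  next
    case False
    \<comment> \<open>The two factors are padded with ones to a product over all coordinates, so
      that independence applies in the form of the product formula for integrals.\<close>
    define h where "h k = (if k = i \<or> k = j then g else (\<lambda>_. 1))" for k
    have "(\<Prod>k<n. h k (u k)) = g (u i) * g (u j)" for u
    proof -
      have "(\<Prod>k<n. h k (u k)) = (\<Prod>k\<in>{i, j}. h k (u k))"
        by (rule prod.mono_neutral_right) (use that in \<open>auto simp: h_def\<close>)
      then show ?thesis using False by (simp add: h_def)
    qed
    then have "(\<integral>u. g (u i) * g (u j) \<partial>(\<Pi>\<^sub>M i\<in>{..<n}. M))
        = (\<integral>u. (\<Prod>k<n. h k (u k)) \<partial>(\<Pi>\<^sub>M i\<in>{..<n}. M))" by simp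
    also have "\<dots> = (\<Prod>k<n. \<integral>x. h k x \<partial>M)"
      by (rule product_integral_prod) (auto simp: h_def g_int)
    also have "\<dots> = 0"
      by (rule prod_zero) (use that g0 in \<open>auto simp: h_def\<close>)
    finally show ?thesis by simp
  qed
  have X2: "(X u)\<^sup>2 = (\<Sum>i<n. \<Sum>j<n. g (u i) * g (u j))" for u
    by (simp add: X_def power2_eq_square sum_product)
  have X2_int: "integrable (\<Pi>\<^sub>M i\<in>{..<n}. M) (\<lambda>u. (X u)\<^sup>2)"
    unfolding X2 by (intro Bochner_Integration.integrable_sum gg_int) auto
  have "(\<integral>u. (X u)\<^sup>2 \<partial>(\<Pi>\<^sub>M i\<in>{..<n}. M))
      = (\<Sum>i<n. \<integral>u. (\<Sum>j<n. g (u i) * g (u j)) \<partial>(\<Pi>\<^sub>M i\<in>{..<n}. M))"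
    unfolding X2 by (rule Bochner_Integration.integral_sum)
      (auto intro!: Bochner_Integration.integrable_sum gg_int)
  also have "\<dots> = (\<Sum>i<n. \<Sum>j<n. \<integral>u. g (u i) * g (u j) \<partial>(\<Pi>\<^sub>M i\<in>{..<n}. M))"
    by (rule sum.cong[OF refl], rule Bochner_Integration.integral_sum) (auto intro!: gg_int)
  also have "\<dots> \<le> (\<Sum>i<n. \<Sum>j<n. of_bool (i = j))"
    by (intro sum_mono gg) auto
  also have "\<dots> = real n" by (simp add: of_bool_def sum.delta)
  finally have var: "(\<integral>u. (X u)\<^sup>2 \<partial>(\<Pi>\<^sub>M i\<in>{..<n}. M)) \<le> real n" .
  have "(\<integral>u. \<bar>X u\<bar> \<partial>(\<Pi>\<^sub>M i\<in>{..<n}. M)) \<le> sqrt (real n)"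
  proof (cases "n = 0")
    case False
    define s where "s = sqrt (real n)"
    have s: "0 < s" "s\<^sup>2 = real n" using False by (auto simp: s_def)
    \<comment> \<open>AM-GM: \<open>2 \<bar>x\<bar> \<le> x\<^sup>2 / s + s\<close>\<close>
    have "(\<integral>u. \<bar>X u\<bar> \<partial>(\<Pi>\<^sub>M i\<in>{..<n}. M)) \<le> (\<integral>u. (X u)\<^sup>2 / (2 * s) + s / 2 \<partial>(\<Pi>\<^sub>M i\<in>{..<n}. M))"
    proof (rule integral_mono[OF int])
      fix u
      have "2 * (\<bar>X u\<bar> * s) \<le> \<bar>X u\<bar>\<^sup>2 + s\<^sup>2" using sum_squares_bound[of "\<bar>X u\<bar>" s] by simp
      then show "\<bar>X u\<bar> \<le> (X u)\<^sup>2 / (2 * s) + s / 2"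
        using s(1) by (simp add: field_simps power2_eq_square)
    qed (use X2_int in auto)
    also have "\<dots> = (\<integral>u. (X u)\<^sup>2 \<partial>(\<Pi>\<^sub>M i\<in>{..<n}. M)) / (2 * s) + s / 2"
      using X2_int by (simp add: P.prob_space)
    also have "\<dots> \<le> s\<^sup>2 / (2 * s) + s / 2"
      using var s by (intro add_mono divide_right_mono) auto
    also have "\<dots> = s" using s(1) by (simp add: power2_eq_square)
    finally show ?thesis by (simp add: s_def)
  qed (simp add: X_def)
  then show "(\<integral>u. \<bar>(\<Sum>i<n. indicator B (u i)) - real n * prob B\<bar> \<partial>(\<Pi>\<^sub>M i\<in>{..<n}. M)) \<le> sqrt (real n)"
    unfolding X_eq .
qed

text \<open>Joint measurability in the record and the offset is what exchanging the expectation with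
  the integral along an edge requires.\<close>

lemma measurable_of_bool_segment_pair:
  fixes N :: "('v, 'e) network"
  assumes "connected_network N"
  shows "(\<lambda>z. of_bool (fst z \<in> segment e (snd z)) :: real) \<in> borel_measurable (location_algebra N \<Otimes>\<^sub>M borel)"
proof -
  interpret connected_net N by standard (rule assms)
  note [measurable] = measurable_snd_location edge_in_sets
  have "(\<lambda>z. indicator {p \<in> locations N. fst p = e} (fst z) * (if snd (fst z) \<le> snd z then 1 else 0 :: real))
      \<in> borel_measurable (location_algebra N \<Otimes>\<^sub>M borel)"
    by measurable
  then show ?thesis
    by (subst measurable_cong[where g = "\<lambda>z. indicator {p \<in> locations N. fst p = e} (fst z) *
        (if snd (fst z) \<le> snd z then 1 else 0 :: real)"])
      (auto simp: space_pair_measure space_location_algebra mem_segment mem_locations)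
qed

section \<open>Square-root upper bound for equal distributions\<close>

context connected_net
begin

text \<open>Since the values of a potential matter only up to a constant, no feasible \<open>c\<close> has to be
  constructed: the dual bound with \<open>c = 0\<close> already controls the matching distance.\<close>

lemma min_matching_le_imbalance:
  assumes D: "\<And>p q. p \<in> locations N \<Longrightarrow> q \<in> locations N \<Longrightarrow> net_dist N p q \<le> D"
    and q: "q \<in> locations N"
    and u: "\<And>i. i < n \<Longrightarrow> u i \<in> locations N" and v: "\<And>i. i < n \<Longrightarrow> v i \<in> locations N"
  shows "min_matching_dist N n u v \<le>
    (\<Sum>e\<in>edges N. D * \<bar>real_of_int (imbalance n (rep \<circ> u) (rep \<circ> v) e (len N e))\<bar>
      + (LBINT x:{0..len N e}. \<bar>real_of_int (imbalance n (rep \<circ> u) (rep \<circ> v) e x)\<bar>))"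
proof -
  obtain \<phi> where \<phi>: "net_lipschitz 1 \<phi>"
    and le: "min_matching_dist N n u v \<le> (\<Sum>i<n. \<phi> (u i)) - (\<Sum>i<n. \<phi> (v i))"
    using kantorovich_potential[of n u v] u v by blast
  \<comment> \<open>Subtracting a constant does not change the difference of the two sums, which
    have equally many terms, and it bounds the potential by the diameter.\<close>
  define \<psi> where "\<psi> p = \<phi> p - \<phi> q" for p
  have \<psi>: "net_lipschitz 1 \<psi>" using \<phi> unfolding net_lipschitz_def \<psi>_def by simp
  have \<psi>D: "\<bar>\<psi> p\<bar> \<le> D" if "p \<in> locations N" for p
    using net_lipschitz_abs[OF \<phi> that q] D[OF that q] unfolding \<psi>_def by linarith
  have \<psi>_rep: "\<psi> (rep p) = \<phi> p - \<phi> q" if "p \<in> locations N" for p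
    using net_lipschitz_net_point[OF \<phi> that rep_in_net_point[OF that]] by (simp add: \<psi>_def)
  let ?u = "rep \<circ> u" and ?v = "rep \<circ> v"
  have loc: "?u i \<in> locations N" "?v i \<in> locations N" if "i < n" for i
    using u v that by (auto intro: rep_in_locations)
  have "(\<Sum>i<n. \<phi> (u i)) - (\<Sum>i<n. \<phi> (v i)) = (\<Sum>i<n. \<psi> (?u i)) - (\<Sum>i<n. \<psi> (?v i))"
    using u v by (simp add: \<psi>_rep sum_subtractf)
  also have "\<dots> = (\<Sum>e\<in>edges N. (\<Sum>i<n. of_bool (fst (?u i) = e) * \<psi> (?u i))
        - (\<Sum>i<n. of_bool (fst (?v i) = e) * \<psi> (?v i)))"
    using sum_by_edge[of n ?u \<psi>] sum_by_edge[of n ?v \<psi>] loc by (simp add: sum_subtractf)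
  also have "\<dots> \<le> (\<Sum>e\<in>edges N. D * \<bar>real_of_int (imbalance n ?u ?v e (len N e))\<bar>
      + (LBINT x:{0..len N e}. \<bar>real_of_int (imbalance n ?u ?v e x)\<bar>))"
  proof (rule sum_mono)
    fix e assume e: "e \<in> edges N"
    let ?s = "real_of_int (imbalance n ?u ?v e (len N e))"
    have "?s * \<psi> (e, len N e) \<le> \<bar>?s * \<psi> (e, len N e)\<bar>" by simp
    also have "\<dots> \<le> D * \<bar>?s\<bar>"
      using \<psi>D[OF end_in_locations[OF e]] unfolding abs_mult
      by (subst mult.commute) (intro mult_right_mono, auto)
    finally have "?s * \<psi> (e, len N e) \<le> D * \<bar>?s\<bar>" .
    moreover have "(\<Sum>i<n. of_bool (fst (?u i) = e) * \<psi> (?u i)) - (\<Sum>i<n. of_bool (fst (?v i) = e) * \<psi> (?v i))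
        \<le> ?s * \<psi> (e, len N e) - 0 * (\<psi> (e, len N e) - \<psi> (e, 0))
          + Psi N e 0 (\<lambda>x. real_of_int (imbalance n ?u ?v e x))"
      by (rule edge_duality[OF e \<psi>]) (use loc in auto)
    ultimately show "(\<Sum>i<n. of_bool (fst (?u i) = e) * \<psi> (?u i)) - (\<Sum>i<n. of_bool (fst (?v i) = e) * \<psi> (?v i))
        \<le> D * \<bar>?s\<bar> + (LBINT x:{0..len N e}. \<bar>real_of_int (imbalance n ?u ?v e x)\<bar>)"
      by (simp add: Psi_def)
  qed
  finally show ?thesis using le by simp
qed

end

context random_network
begin

text \<open>The preimage \<open>B\<close> of a segment under \<open>rep\<close> contains all records
  of its points, so both measures give it the same probability. The two counts fluctuate around the
  same mean, each by at most \<open>sqrt n\<close> on average, hence the factor 2.\<close>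

lemma imbalance_expectation:
  assumes same: "same_distribution N \<mu> \<nu>" and e: "e \<in> edges N"
  shows "integrable (samples n) (\<lambda>\<omega>. \<bar>real_of_int (imbalance n (rep \<circ> fst \<omega>) (rep \<circ> snd \<omega>) e x)\<bar>)"
    and "(\<integral>\<omega>. \<bar>real_of_int (imbalance n (rep \<circ> fst \<omega>) (rep \<circ> snd \<omega>) e x)\<bar> \<partial>samples n) \<le> 2 * sqrt (real n)"
proof -
  interpret S: prob_space "samples n" by (rule prob_space_samples)
  define B where "B = rep -` {p \<in> locations N. p \<in> segment e x} \<inter> space (location_algebra N)"
  have B: "B \<in> sets (location_algebra N)"
    unfolding B_def by (rule measurable_sets[OF measurable_rep segment_in_sets[OF e]])
  have mem_B: "p \<in> B \<longleftrightarrow> rep p \<in> segment e x" if "p \<in> locations N" for p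
    using that rep_in_locations by (auto simp: B_def space_location_algebra)
  have "net_point N p \<subseteq> B" if p: "p \<in> B" for p
  proof
    fix q assume q: "q \<in> net_point N p"
    have loc: "p \<in> locations N" "q \<in> locations N"
      using p q by (auto simp: B_def space_location_algebra mem_net_point)
    then show "q \<in> B" using rep_eq[OF loc(1) q] mem_B p by simp
  qed
  then have eq: "measure \<mu> B = measure \<nu> B" using same B unfolding same_distribution_def by blast
  have B\<mu>: "B \<in> sets \<mu>" and B\<nu>: "B \<in> sets \<nu>" using B by (simp_all add: sets_\<mu> sets_\<nu>)
  define P where "P u = \<bar>(\<Sum>i<n. indicator B (u i)) - real n * measure \<mu> B\<bar>" for u :: "nat \<Rightarrow> 'e \<times> real"
  have dev: "integrable (\<Pi>\<^sub>M i\<in>{..<n}. \<mu>) P" "(\<integral>u. P u \<partial>(\<Pi>\<^sub>M i\<in>{..<n}. \<mu>)) \<le> sqrt (real n)"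
    "integrable (\<Pi>\<^sub>M i\<in>{..<n}. \<nu>) P" "(\<integral>u. P u \<partial>(\<Pi>\<^sub>M i\<in>{..<n}. \<nu>)) \<le> sqrt (real n)"
    using M1.count_deviation[OF B\<mu>, of n] M2.count_deviation[OF B\<nu>, of n] unfolding P_def eq by auto
  have meas: "P \<in> borel_measurable (\<Pi>\<^sub>M i\<in>{..<n}. \<mu>)" "P \<in> borel_measurable (\<Pi>\<^sub>M i\<in>{..<n}. \<nu>)"
    using dev(1,3) by auto
  have Pf: "integrable (samples n) (\<lambda>\<omega>. P (fst \<omega>))" "(\<integral>\<omega>. P (fst \<omega>) \<partial>samples n) \<le> sqrt (real n)"
    using dev(1,2) integrable_distr_eq[OF measurable_fst meas(1), of "\<Pi>\<^sub>M i\<in>{..<n}. \<nu>"]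
      integral_distr[OF measurable_fst meas(1), of "\<Pi>\<^sub>M i\<in>{..<n}. \<nu>"] by (simp_all add: distr_samples)
  have Ps: "integrable (samples n) (\<lambda>\<omega>. P (snd \<omega>))" "(\<integral>\<omega>. P (snd \<omega>) \<partial>samples n) \<le> sqrt (real n)"
    using dev(3,4) integrable_distr_eq[OF measurable_snd meas(2), of "\<Pi>\<^sub>M i\<in>{..<n}. \<mu>"]
      integral_distr[OF measurable_snd meas(2), of "\<Pi>\<^sub>M i\<in>{..<n}. \<mu>"] by (simp_all add: distr_samples)
  define T where "T \<omega> = real_of_int (imbalance n (rep \<circ> fst \<omega>) (rep \<circ> snd \<omega>) e x)"
    for \<omega> :: "(nat \<Rightarrow> 'e \<times> real) \<times> (nat \<Rightarrow> 'e \<times> real)"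
  have T: "T \<omega> = (\<Sum>i<n. indicator B (fst \<omega> i)) - (\<Sum>i<n. indicator B (snd \<omega> i))"
    if "\<omega> \<in> space (samples n)" for \<omega>
  proof -
    have "(of_bool (rep p \<in> segment e x) :: real) = indicator B p" if "p \<in> locations N" for p
      using mem_B[OF that] by (simp add: indicator_def)
    then show ?thesis
      unfolding T_def imbalance_eq_sum comp_def using sample_in_locations[OF that]
      by (intro arg_cong2[where f = "(-)"] sum.cong) auto
  qed
  have T_le: "\<bar>T \<omega>\<bar> \<le> P (fst \<omega>) + P (snd \<omega>)" if "\<omega> \<in> space (samples n)" for \<omega>
    unfolding T[OF that] P_def by linarith
  have T_meas: "T \<in> borel_measurable (samples n)"
  proof (subst measurable_cong[OF T])
    show "(\<lambda>\<omega>. (\<Sum>i<n. indicator B (fst \<omega> i)) - (\<Sum>i<n. indicator B (snd \<omega> i)) :: real) \<in> borel_measurable (samples n)"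
      by (intro borel_measurable_diff borel_measurable_sum
          measurable_compose[OF measurable_sample(1)] measurable_compose[OF measurable_sample(2)])
        (use B\<mu> B\<nu> in auto)
  qed
  show int: "integrable (samples n) (\<lambda>\<omega>. \<bar>real_of_int (imbalance n (rep \<circ> fst \<omega>) (rep \<circ> snd \<omega>) e x)\<bar>)"
    by (rule S.integrable_const_bound[where B = "real n", OF AE_I2 borel_measurable_abs[OF T_meas, unfolded T_def]])
      (simp add: imbalance_bound)
  have "(\<integral>\<omega>. \<bar>T \<omega>\<bar> \<partial>samples n) \<le> (\<integral>\<omega>. P (fst \<omega>) + P (snd \<omega>) \<partial>samples n)"
    using int unfolding T_def[symmetric]
    by (intro integral_mono T_le Bochner_Integration.integrable_add Pf(1) Ps(1))
  also have "\<dots> \<le> 2 * sqrt (real n)" using Pf Ps by simp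
  finally show "(\<integral>\<omega>. \<bar>real_of_int (imbalance n (rep \<circ> fst \<omega>) (rep \<circ> snd \<omega>) e x)\<bar> \<partial>samples n) \<le> 2 * sqrt (real n)"
    unfolding T_def .
qed

lemma measurable_imbalance_pair:
  "(\<lambda>z. real_of_int (imbalance n (rep \<circ> fst (fst z)) (rep \<circ> snd (fst z)) e (snd z)))
    \<in> borel_measurable (samples n \<Otimes>\<^sub>M borel)"
proof -
  note seg = measurable_of_bool_segment_pair[OF connected, of e]
  have rep: "rep \<in> \<mu> \<rightarrow>\<^sub>M location_algebra N" "rep \<in> \<nu> \<rightarrow>\<^sub>M location_algebra N"
    using measurable_rep by (simp_all cong: measurable_cong_sets add: sets_\<mu> sets_\<nu>)
  have "(\<lambda>z. of_bool (rep (fst (fst z) i) \<in> segment e (snd z)) :: real) \<in> borel_measurable (samples n \<Otimes>\<^sub>M borel)"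
    "(\<lambda>z. of_bool (rep (snd (fst z) i) \<in> segment e (snd z)) :: real) \<in> borel_measurable (samples n \<Otimes>\<^sub>M borel)"
    if i: "i < n" for i
  proof -
    have "(\<lambda>z. (rep (fst (fst z) i), snd z)) \<in> samples n \<Otimes>\<^sub>M borel \<rightarrow>\<^sub>M location_algebra N \<Otimes>\<^sub>M borel"
      by (intro measurable_Pair measurable_snd
          measurable_compose[OF measurable_compose[OF measurable_fst measurable_sample(1)[OF i]] rep(1)])
    from measurable_compose[OF this seg]
    show "(\<lambda>z. of_bool (rep (fst (fst z) i) \<in> segment e (snd z)) :: real) \<in> borel_measurable (samples n \<Otimes>\<^sub>M borel)"
      by simp
    have "(\<lambda>z. (rep (snd (fst z) i), snd z)) \<in> samples n \<Otimes>\<^sub>M borel \<rightarrow>\<^sub>M location_algebra N \<Otimes>\<^sub>M borel"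
      by (intro measurable_Pair measurable_snd
          measurable_compose[OF measurable_compose[OF measurable_fst measurable_sample(2)[OF i]] rep(2)])
    from measurable_compose[OF this seg]
    show "(\<lambda>z. of_bool (rep (snd (fst z) i) \<in> segment e (snd z)) :: real) \<in> borel_measurable (samples n \<Otimes>\<^sub>M borel)"
      by simp
  qed
  then show ?thesis
    unfolding imbalance_eq_sum comp_def by (intro borel_measurable_diff borel_measurable_sum) auto
qed

lemma expected_Z_CF_sqrt_upper:
  assumes same: "same_distribution N \<mu> \<nu>"
  shows "\<exists>C. \<forall>n. expected_Z_CF N \<mu> \<nu> n \<le> C * sqrt (real n)"
proof -
  obtain D where D: "0 \<le> D" "\<And>p q. p \<in> locations N \<Longrightarrow> q \<in> locations N \<Longrightarrow> net_dist N p q \<le> D"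
    using net_dist_bounded by blast
  obtain q where q: "q \<in> locations N" using M1.not_empty by (auto simp: space_\<mu>)
  \<comment> \<open>For each edge, \<open>D\<close> weights the imbalance at the far end and the
    length arises from integrating along the edge; both are multiplied by the 2 of
    \<open>imbalance_expectation\<close>.\<close>
  define C where "C = (\<Sum>e\<in>edges N. D * 2 + len N e * 2)"
  have C: "0 \<le> C" unfolding C_def using D(1) len_nonneg by (intro sum_nonneg) auto
  have "expected_Z_CF N \<mu> \<nu> n \<le> C * sqrt (real n)" for n
  proof -
    interpret S: prob_space "samples n" by (rule prob_space_samples)
    interpret SL: pair_sigma_finite "samples n" lborel ..
    let ?S = "\<lambda>\<omega> e x. real_of_int (imbalance n (rep \<circ> fst \<omega>) (rep \<circ> snd \<omega>) e x)"
    have "(\<lambda>z. ?S (fst z) e (snd z)) \<in> borel_measurable (samples n \<Otimes>\<^sub>M lborel)" for e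
      using measurable_imbalance_pair[of n e]
      by (simp cong: measurable_cong_sets sets_pair_measure_cong)
    then have F: "(\<lambda>(\<omega>, x). indicator {0..len N e} x * ennreal \<bar>?S \<omega> e x\<bar>)
        \<in> borel_measurable (samples n \<Otimes>\<^sub>M lborel)" for e
      unfolding case_prod_beta by measurable
    \<comment> \<open>The estimate is carried out with nonnegative extended integrals, for which the
      exchange of integrals asks only for joint measurability.\<close>
    have "ennreal (expected_Z_CF N \<mu> \<nu> n)
        = (\<integral>\<^sup>+\<omega>. ennreal (min_matching_dist N n (fst \<omega>) (snd \<omega>)) \<partial>samples n)"
      unfolding expected_Z_CF_eq using min_matching_bounds
      by (intro nn_integral_eq_integral[symmetric] integrable_min_matching AE_I2) blast
    also have "\<dots> \<le> (\<integral>\<^sup>+\<omega>. (\<Sum>e\<in>edges N. ennreal D * ennreal \<bar>?S \<omega> e (len N e)\<bar>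
        + (\<integral>\<^sup>+x. indicator {0..len N e} x * ennreal \<bar>?S \<omega> e x\<bar> \<partial>lborel)) \<partial>samples n)"
    proof (rule nn_integral_mono)
      fix \<omega> assume \<omega>: "\<omega> \<in> space (samples n)"
      have nonneg: "0 \<le> (LBINT x:{0..len N e}. \<bar>?S \<omega> e x\<bar>)" for e
        unfolding set_lebesgue_integral_def by (intro integral_nonneg_AE) auto
      have int: "ennreal (LBINT x:{0..len N e}. \<bar>?S \<omega> e x\<bar>)
          = (\<integral>\<^sup>+x. indicator {0..len N e} x * ennreal \<bar>?S \<omega> e x\<bar> \<partial>lborel)" for e
      proof -
        have "integrable lborel (\<lambda>x. indicator {0..len N e} x *\<^sub>R \<bar>?S \<omega> e x\<bar>)"
          using imbalance_integrable_Icc[of 0 "len N e" n "rep \<circ> fst \<omega>" "rep \<circ> snd \<omega>" e 0]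
          by (simp add: set_integrable_def)
        then show ?thesis
          unfolding set_lebesgue_integral_def
          by (subst nn_integral_eq_integral[symmetric])
            (auto intro!: nn_integral_cong simp: indicator_def)
      qed
      have "min_matching_dist N n (fst \<omega>) (snd \<omega>) \<le> (\<Sum>e\<in>edges N. D * \<bar>?S \<omega> e (len N e)\<bar>
        + (LBINT x:{0..len N e}. \<bar>?S \<omega> e x\<bar>))"
        by (rule min_matching_le_imbalance[OF D(2) q])
          (use sample_in_locations[OF \<omega>] in auto)
      then have "ennreal (min_matching_dist N n (fst \<omega>) (snd \<omega>))
        \<le> ennreal (\<Sum>e\<in>edges N. D * \<bar>?S \<omega> e (len N e)\<bar> + (LBINT x:{0..len N e}. \<bar>?S \<omega> e x\<bar>))"
        by (rule ennreal_leI)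
      also have "\<dots> = (\<Sum>e\<in>edges N. ennreal (D * \<bar>?S \<omega> e (len N e)\<bar> + (LBINT x:{0..len N e}. \<bar>?S \<omega> e x\<bar>)))"
        using nonneg D(1) by (intro sum_ennreal[symmetric]) auto
      also have "\<dots> = (\<Sum>e\<in>edges N. ennreal D * ennreal \<bar>?S \<omega> e (len N e)\<bar>
        + (\<integral>\<^sup>+x. indicator {0..len N e} x * ennreal \<bar>?S \<omega> e x\<bar> \<partial>lborel))"
        unfolding int[symmetric] using nonneg D(1) by (simp add: ennreal_plus ennreal_mult)
      finally show "ennreal (min_matching_dist N n (fst \<omega>) (snd \<omega>)) \<le> (\<Sum>e\<in>edges N.
        ennreal D * ennreal \<bar>?S \<omega> e (len N e)\<bar>
        + (\<integral>\<^sup>+x. indicator {0..len N e} x * ennreal \<bar>?S \<omega> e x\<bar> \<partial>lborel))" .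
    qed
    also have "\<dots> = (\<Sum>e\<in>edges N. ennreal D * (\<integral>\<^sup>+\<omega>. ennreal \<bar>?S \<omega> e (len N e)\<bar> \<partial>samples n)
        + (\<integral>\<^sup>+\<omega>. (\<integral>\<^sup>+x. indicator {0..len N e} x * ennreal \<bar>?S \<omega> e x\<bar> \<partial>lborel) \<partial>samples n))"
    proof -
      have m1: "(\<lambda>\<omega>. ?S \<omega> e x) \<in> borel_measurable (samples n)" for e x
        using measurable_compose[OF _ measurable_imbalance_pair[of n e], of "\<lambda>\<omega>. (\<omega>, x)" "samples n"] by simp
      have m2: "(\<lambda>\<omega>. \<integral>\<^sup>+x. indicator {0..len N e} x * ennreal \<bar>?S \<omega> e x\<bar> \<partial>lborel) \<in> borel_measurable (samples n)" for e
        by (rule lborel.borel_measurable_nn_integral[OF F])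
      show ?thesis
        using m1 m2 by (simp add: nn_integral_sum nn_integral_add nn_integral_cmult)
    qed
    also have "\<dots> \<le> (\<Sum>e\<in>edges N. ennreal D * ennreal (2 * sqrt (real n)) + ennreal (len N e) * ennreal (2 * sqrt (real n)))"
    proof (intro sum_mono add_mono mult_left_mono)
      fix e assume e: "e \<in> edges N"
      have bound: "(\<integral>\<^sup>+\<omega>. ennreal \<bar>?S \<omega> e x\<bar> \<partial>samples n) \<le> ennreal (2 * sqrt (real n))" for x
        using imbalance_expectation[OF same e, of n x]
        by (subst nn_integral_eq_integral) (auto intro: ennreal_leI)
      then show "(\<integral>\<^sup>+\<omega>. ennreal \<bar>?S \<omega> e (len N e)\<bar> \<partial>samples n) \<le> ennreal (2 * sqrt (real n))" .
      have "(\<integral>\<^sup>+\<omega>. (\<integral>\<^sup>+x. indicator {0..len N e} x * ennreal \<bar>?S \<omega> e x\<bar> \<partial>lborel) \<partial>samples n)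
          = (\<integral>\<^sup>+x. (\<integral>\<^sup>+\<omega>. indicator {0..len N e} x * ennreal \<bar>?S \<omega> e x\<bar> \<partial>samples n) \<partial>lborel)"
        by (rule SL.Fubini'[symmetric, OF F])
      also have "\<dots> \<le> (\<integral>\<^sup>+x. ennreal (2 * sqrt (real n)) * indicator {0..len N e} x \<partial>lborel)"
      proof (rule nn_integral_mono)
        fix x
        show "(\<integral>\<^sup>+\<omega>. indicator {0..len N e} x * ennreal \<bar>?S \<omega> e x\<bar> \<partial>samples n)
          \<le> ennreal (2 * sqrt (real n)) * indicator {0..len N e} x"
          using bound[of x] by (cases "x \<in> {0..len N e}") auto
      qed
      also have "\<dots> = ennreal (len N e) * ennreal (2 * sqrt (real n))"
        using len_nonneg[OF e] by (subst nn_integral_cmult_indicator) (auto simp: mult.commute)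
      finally show "(\<integral>\<^sup>+\<omega>. (\<integral>\<^sup>+x. indicator {0..len N e} x * ennreal \<bar>?S \<omega> e x\<bar> \<partial>lborel) \<partial>samples n)
          \<le> ennreal (len N e) * ennreal (2 * sqrt (real n))" .
    qed simp
    also have "\<dots> = ennreal (C * sqrt (real n))"
    proof -
      have "(\<Sum>e\<in>edges N. ennreal D * ennreal (2 * sqrt (real n)) + ennreal (len N e) * ennreal (2 * sqrt (real n)))
        = (\<Sum>e\<in>edges N. ennreal ((D * 2 + len N e * 2) * sqrt (real n)))"
        using D(1) len_nonneg
        by (intro sum.cong refl) (simp add: ennreal_mult[symmetric] ennreal_plus[symmetric] algebra_simps del: ennreal_plus)
      also have "\<dots> = ennreal (\<Sum>e\<in>edges N. (D * 2 + len N e * 2) * sqrt (real n))"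
        using D(1) len_nonneg by (intro sum_ennreal) auto
      finally show ?thesis unfolding C_def by (simp add: sum_distrib_right)
    qed
    finally show ?thesis using C by (simp add: ennreal_le_iff)
  qed
  then show ?thesis by blast
qed

end

section \<open>Anticoncentration of sums\<close>

text \<open>Centring multiplies the characteristic function by a number of modulus 1. The centred
  one is \<open>1 - t\<^sup>2 * \<sigma>2 / 2\<close> up to an error of third order, where the
  variance \<open>\<sigma>2\<close> is positive because \<open>f\<close> is not almost surely
  constant.\<close>

lemma (in prob_space) char_decay:
  assumes f [measurable]: "f \<in> borel_measurable M" and B: "\<And>x. x \<in> space M \<Longrightarrow> \<bar>f x\<bar> \<le> B"
    and nonconst: "\<not> (AE x in M. f x = expectation f)"
  obtains a t0 where "0 < a" "0 < t0"
    "\<And>t. 0 \<le> t \<Longrightarrow> t \<le> t0 \<Longrightarrow> cmod (CLINT x|M. iexp (t * f x)) \<le> 1 - a * t\<^sup>2"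
proof -
  define m where "m = expectation f"
  define X where "X x = f x - m" for x
  define \<sigma>2 where "\<sigma>2 = expectation (\<lambda>x. (X x)\<^sup>2)"
  define C where "C = \<bar>B\<bar> + \<bar>m\<bar> + 1"
  have X [measurable]: "X \<in> borel_measurable M" unfolding X_def by measurable
  have XC: "\<bar>X x\<bar> \<le> C" if "x \<in> space M" for x using B[OF that] unfolding X_def C_def by linarith
  have f_int: "integrable M f" by (rule integrable_const_bound[where B = B]) (auto intro: B)
  have X_int: "integrable M X" unfolding X_def using f_int by simp
  have X0: "expectation X = 0" unfolding X_def using f_int by (simp add: prob_space m_def)
  have X2_int: "integrable M (\<lambda>x. (X x)\<^sup>2)"
  proof (rule integrable_const_bound[where B = "C\<^sup>2", OF AE_I2])
    show "norm ((X x)\<^sup>2) \<le> C\<^sup>2" if "x \<in> space M" for x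
      using power_mono[OF XC[OF that], of 2] by simp
  qed measurable
  have var: "variance X = \<sigma>2" unfolding \<sigma>2_def X0 by simp
  have "0 \<le> \<sigma>2" unfolding \<sigma>2_def by (rule integral_nonneg_AE) simp
  moreover have "\<sigma>2 \<noteq> 0"
  proof
    assume "\<sigma>2 = 0"
    then have "AE x in M. (X x)\<^sup>2 = 0"
      unfolding \<sigma>2_def by (subst (asm) integral_nonneg_eq_0_iff_AE) (use X2_int in auto)
    then have "AE x in M. f x = expectation f" by (simp add: X_def m_def)
    with nonconst show False ..
  qed
  ultimately have \<sigma>2: "0 < \<sigma>2" by simp
  have C: "0 < C" by (simp add: C_def)
  \<comment> \<open>The first bound gives \<open>t \<le> 1\<close> and
    \<open>t * \<sigma>2 \<le> 1\<close>, so the main term is nonnegative and equals its modulus.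
    The second bounds the error \<open>t\<^sup>2 / 6 * (t * C ^ 3)\<close> by
    \<open>t\<^sup>2 * \<sigma>2 / 4\<close>, half of the gain. The summand 1 in \<open>C\<close>
    makes this denominator positive.\<close>
  define t0 where "t0 = min (1 / (1 + \<sigma>2)) (3 * \<sigma>2 / (2 * C ^ 3))"
  have t0: "0 < t0" using \<sigma>2 C by (simp add: t0_def)
  have "cmod (CLINT x|M. iexp (t * f x)) \<le> 1 - \<sigma>2 / 4 * t\<^sup>2" if t: "0 \<le> t" "t \<le> t0" for t
  proof -
    have "(CLINT x|M. iexp (t * f x)) = (CLINT x|M. iexp (t * m) * iexp (t * X x))"
      by (intro Bochner_Integration.integral_cong refl) (simp add: X_def exp_add[symmetric] algebra_simps)
    also have "\<dots> = iexp (t * m) * (CLINT x|M. iexp (t * X x))" by simp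
    finally have "cmod (CLINT x|M. iexp (t * f x)) = cmod (CLINT x|M. iexp (t * X x))"
      by (simp add: norm_mult)
    also have "(CLINT x|M. iexp (t * X x)) = char (distr M borel X) t"
      unfolding char_def by (subst integral_distr) auto
    also have "cmod (char (distr M borel X) t)
        \<le> cmod (char (distr M borel X) t - (1 - t\<^sup>2 * \<sigma>2 / 2)) + cmod (1 - t\<^sup>2 * \<sigma>2 / 2)"
      using norm_triangle_ineq[of "char (distr M borel X) t - (1 - t\<^sup>2 * \<sigma>2 / 2)" "1 - t\<^sup>2 * \<sigma>2 / 2"] by simp
    also have "cmod (char (distr M borel X) t - (1 - t\<^sup>2 * \<sigma>2 / 2))
        \<le> (t\<^sup>2 / 6) * expectation (\<lambda>x. min (6 * (X x)\<^sup>2) (\<bar>t\<bar> * \<bar>X x\<bar> ^ 3))"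
      by (rule char_approx3'[OF X X_int X2_int X0 var refl])
    also have "\<dots> \<le> (t\<^sup>2 / 6) * (t * C ^ 3)"
    proof (rule mult_left_mono)
      have "expectation (\<lambda>x. min (6 * (X x)\<^sup>2) (\<bar>t\<bar> * \<bar>X x\<bar> ^ 3)) \<le> expectation (\<lambda>_. t * C ^ 3)"
      proof (rule integral_mono)
        show "integrable M (\<lambda>x. min (6 * (X x)\<^sup>2) (\<bar>t\<bar> * \<bar>X x\<bar> ^ 3))"
        proof (rule Bochner_Integration.integrable_bound[where f = "\<lambda>x. 6 * (X x)\<^sup>2"])
          show "AE x in M. norm (min (6 * (X x)\<^sup>2) (\<bar>t\<bar> * \<bar>X x\<bar> ^ 3)) \<le> norm (6 * (X x)\<^sup>2)"
            by (auto simp: min_def)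
        qed (use X2_int in auto)
        show "min (6 * (X x)\<^sup>2) (\<bar>t\<bar> * \<bar>X x\<bar> ^ 3) \<le> t * C ^ 3" if "x \<in> space M" for x
          using power_mono[OF XC[OF that], of 3] t(1) by (simp add: min.coboundedI2 mult_left_mono)
      qed simp
      then show "expectation (\<lambda>x. min (6 * (X x)\<^sup>2) (\<bar>t\<bar> * \<bar>X x\<bar> ^ 3)) \<le> t * C ^ 3"
        by (simp add: prob_space)
    qed simp
    also have "\<dots> \<le> (t\<^sup>2 / 6) * (3 * \<sigma>2 / 2)"
    proof (rule mult_left_mono)
      have "t \<le> 3 * \<sigma>2 / (2 * C ^ 3)" using t(2) by (simp add: t0_def)
      then show "t * C ^ 3 \<le> 3 * \<sigma>2 / 2" using C by (simp add: field_simps)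
    qed simp
    also have "cmod (1 - t\<^sup>2 * \<sigma>2 / 2) = 1 - t\<^sup>2 * \<sigma>2 / 2"
    proof -
      have "t \<le> 1 / (1 + \<sigma>2)" using t(2) by (simp add: t0_def)
      then have "t * (1 + \<sigma>2) \<le> 1" using \<sigma>2 by (simp add: field_simps)
      moreover have "0 \<le> t * \<sigma>2" using t(1) \<sigma>2 by simp
      ultimately have "t \<le> 1" "t * \<sigma>2 \<le> 1" using t(1) by (simp_all add: distrib_left)
      then have "t * (t * \<sigma>2) \<le> 1 * 1" using t(1) \<sigma>2 by (intro mult_mono) auto
      then have "0 \<le> 1 - t\<^sup>2 * \<sigma>2 / 2" by (simp add: power2_eq_square)
      moreover have "cmod (1 - t\<^sup>2 * \<sigma>2 / 2) = \<bar>1 - t\<^sup>2 * \<sigma>2 / 2\<bar>"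
        by (metis norm_of_real of_real_1 of_real_diff of_real_divide of_real_mult of_real_numeral of_real_power)
      ultimately show ?thesis by simp
    qed
    finally show ?thesis by (simp add: algebra_simps)
  qed
  with \<sigma>2 t0 show thesis by (intro that[of "\<sigma>2 / 4" t0]) auto
qed

text \<open>\<open>t E|S| \<ge> 1 - |E exp(i t S)|\<close> because \<open>|exp(i y) - 1| \<le> |y|\<close>. Taking \<open>t\<close> of order
  \<open>1 / sqrt n\<close> keeps the characteristic function of the sum away from 1.\<close>

lemma (in prob_space) sum_anticoncentration:
  assumes f [measurable]: "f \<in> borel_measurable M" and B: "\<And>x. x \<in> space M \<Longrightarrow> \<bar>f x\<bar> \<le> B"
    and nonconst: "\<not> (AE x in M. f x = expectation f)"
  shows "\<exists>c>0. \<forall>n k. c * sqrt (real n) \<le> (\<integral>u. \<bar>(\<Sum>i<n. f (u i)) - k\<bar> \<partial>(\<Pi>\<^sub>M i\<in>{..<n}. M))"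
proof -
  obtain a t0 where a: "0 < a" and t0: "0 < t0"
    and decay: "\<And>t. 0 \<le> t \<Longrightarrow> t \<le> t0 \<Longrightarrow> cmod (CLINT x|M. iexp (t * f x)) \<le> 1 - a * t\<^sup>2"
    using char_decay[OF f B nonconst] by blast
  \<comment> \<open>For \<open>t = t0 / sqrt n\<close> one has
    \<open>n * t\<^sup>2 = t0\<^sup>2\<close>, so the characteristic function of the sum has modulus
    at most \<open>exp (- (a * t0\<^sup>2))\<close>; dividing its distance from 1 by
    \<open>t\<close> gives \<open>c * sqrt n\<close>.\<close>
  define c where "c = (1 - exp (- (a * t0\<^sup>2))) / t0"
  have c: "0 < c" using a t0 by (simp add: c_def)
  have "c * sqrt (real n) \<le> (\<integral>u. \<bar>(\<Sum>i<n. f (u i)) - k\<bar> \<partial>(\<Pi>\<^sub>M i\<in>{..<n}. M))" for n k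
  proof (cases "n = 0")
    case True
    then show ?thesis by simp
  next
    case False
    let ?P = "\<Pi>\<^sub>M i\<in>{..<n}. M"
    interpret P: prob_space ?P by (intro prob_space_PiM prob_space_axioms)
    interpret product_sigma_finite "\<lambda>_. M" ..
    define t where "t = t0 / sqrt (real n)"
    have t: "0 < t" "t \<le> t0" using False t0 by (auto simp: t_def divide_le_eq)
    have tn: "real n * t\<^sup>2 = t0\<^sup>2" using False by (simp add: t_def power_divide)
    define S where "S u = (\<Sum>i<n. f (u i)) - k" for u
    have fi: "(\<lambda>u. f (u i)) \<in> borel_measurable ?P" if "i < n" for i
      using measurable_compose[OF measurable_component_singleton[of i "{..<n}" "\<lambda>_. M"] f] that by simp
    have S [measurable]: "S \<in> borel_measurable ?P"
      unfolding S_def by (intro borel_measurable_diff borel_measurable_sum fi) auto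
    have Sb: "\<bar>S u\<bar> \<le> real n * B + \<bar>k\<bar>" if "u \<in> space ?P" for u
    proof -
      have "\<bar>\<Sum>i<n. f (u i)\<bar> \<le> (\<Sum>i<n. B)"
        using that by (intro order_trans[OF sum_abs sum_mono] B) (auto simp: space_PiM)
      then show ?thesis unfolding S_def by simp
    qed
    have S_int: "integrable ?P S" 
      by (rule P.integrable_const_bound[where B = "real n * B + \<bar>k\<bar>", OF AE_I2 S]) (simp add: Sb)
    have e_int: "integrable ?P (\<lambda>u. iexp (t * S u))"
      by (rule P.integrable_const_bound[where B = 1]) auto
    \<comment> \<open>The shift by \<open>k\<close> contributes only a factor of modulus 1, which
      makes the bound uniform in \<open>k\<close>.\<close>
    have "(CLINT u|?P. iexp (t * S u)) = (CLINT u|?P. iexp (- (t * k)) * (\<Prod>i<n. iexp (t * f (u i))))"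
      by (intro Bochner_Integration.integral_cong refl)
        (simp add: S_def exp_sum[symmetric] exp_add[symmetric] sum_distrib_left algebra_simps)
    also have "\<dots> = iexp (- (t * k)) * (CLINT u|?P. (\<Prod>i<n. iexp (t * f (u i))))" by simp
    also have "(CLINT u|?P. (\<Prod>i<n. iexp (t * f (u i)))) = (\<Prod>i<n. CLINT x|M. iexp (t * f x))"
      by (rule product_integral_prod) (auto intro: integrable_const_bound[where B = 1])
    finally have "cmod (CLINT u|?P. iexp (t * S u)) = cmod (CLINT x|M. iexp (t * f x)) ^ n"
      by (simp add: norm_mult norm_power)
    also have "\<dots> \<le> exp (- (a * t\<^sup>2)) ^ n"
    proof (rule power_mono)
      show "cmod (CLINT x|M. iexp (t * f x)) \<le> exp (- (a * t\<^sup>2))"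
        using decay[of t] t exp_ge_add_one_self[of "- (a * t\<^sup>2)"] by linarith
    qed simp
    also have "\<dots> = exp (- (a * t0\<^sup>2))"
      by (simp add: exp_of_nat_mult[symmetric] tn[symmetric] algebra_simps)
    finally have "1 - exp (- (a * t0\<^sup>2)) \<le> cmod 1 - cmod (CLINT u|?P. iexp (t * S u))" by simp
    also have "\<dots> \<le> cmod ((CLINT u|?P. iexp (t * S u)) - 1)"
      by (metis norm_minus_commute norm_triangle_ineq2)
    also have "(CLINT u|?P. iexp (t * S u)) - 1 = (CLINT u|?P. iexp (t * S u) - 1)"
      using e_int by (simp add: P.prob_space)
    also have "cmod \<dots> \<le> (\<integral>u. cmod (iexp (t * S u) - 1) \<partial>?P)" by (rule integral_norm_bound)
    also have "\<dots> \<le> (\<integral>u. t * \<bar>S u\<bar> \<partial>?P)"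
    proof (rule integral_mono)
      show "cmod (iexp (t * S u) - 1) \<le> t * \<bar>S u\<bar>" for u
        using iexp_approx1[of "t * S u" 0] t(1) by (simp add: abs_mult)
    qed (use e_int S_int in auto)
    also have "\<dots> = t * (\<integral>u. \<bar>S u\<bar> \<partial>?P)" by simp
    finally show ?thesis
      using t(1) t0 False unfolding c_def S_def t_def by (simp add: field_simps)
  qed
  with c show ?thesis by blast
qed

section \<open>Square-root lower bound and asymptotic orders\<close>

context random_network
begin

text \<open>Compactness: otherwise every location is the centre of a null ball, finitely many of
  these balls cover each edge, and the whole network is a null set.\<close>

lemma support_point:
  "\<exists>q\<in>locations N. \<forall>r>0. 0 < measure \<mu> {p \<in> locations N. net_dist N p q < r}"
proof (rule ccontr)
  assume "\<not> ?thesis"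
  then have "\<forall>q\<in>locations N. \<exists>r>0. measure \<mu> {p \<in> locations N. net_dist N p q < r} = 0"
    by (auto simp: not_less measure_le_0_iff)
  then obtain r where r: "\<forall>q\<in>locations N. 0 < r q \<and> measure \<mu> {p \<in> locations N. net_dist N p q < r q} = 0"
    using bchoice[of "locations N" "\<lambda>q r. 0 < r \<and> measure \<mu> {p \<in> locations N. net_dist N p q < r} = 0"]
    by blast
  have null: "{p \<in> locations N. net_dist N p q < r q} \<in> null_sets \<mu>" if q: "q \<in> locations N" for q
  proof -
    have "{p \<in> space (location_algebra N). net_dist N p q < r q} \<in> sets (location_algebra N)"
      using measurable_net_dist_point[OF q] by measurable
    then show ?thesis
      using r q by (simp add: null_sets_def sets_\<mu> space_location_algebra M1.emeasure_eq_measure)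
  qed
  have "{p \<in> locations N. fst p = e} \<in> null_sets \<mu>" if e: "e \<in> edges N" for e
  proof -
    let ?I = "{0..len N e}"
    have loc: "(e, x) \<in> locations N" if "x \<in> ?I" for x using e that by (auto simp: mem_locations)
    obtain F where F: "F \<subseteq> ?I" "finite F" "?I \<subseteq> (\<Union>x\<in>F. ball x (r (e, x)))"
    proof (rule compactE_image[where S = ?I and C = ?I and f = "\<lambda>x. ball x (r (e, x))"])
      show "?I \<subseteq> (\<Union>x\<in>?I. ball x (r (e, x)))" using r loc by (auto intro!: bexI)
    qed auto
    have cover: "(\<Union>x\<in>F. {p \<in> locations N. net_dist N p (e, x) < r (e, x)}) \<in> null_sets \<mu>"
      using F(1,2) null loc by (intro null_sets.finite_UN) auto
    have "{p \<in> locations N. fst p = e} \<subseteq> (\<Union>x\<in>F. {p \<in> locations N. net_dist N p (e, x) < r (e, x)})"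
    proof
      fix p assume "p \<in> {p \<in> locations N. fst p = e}"
      then obtain y where p: "p = (e, y)" "(e, y) \<in> locations N" by (cases p) auto
      then have "y \<in> ?I" by (auto simp: mem_locations)
      then obtain x where x: "x \<in> F" "dist x y < r (e, x)" using F(3) by (auto simp: dist_commute)
      have "net_dist N p (e, x) \<le> \<bar>y - x\<bar>"
        unfolding p(1) using F(1) x(1) by (intro net_dist_edge p(2) loc) auto
      then show "p \<in> (\<Union>x\<in>F. {p \<in> locations N. net_dist N p (e, x) < r (e, x)})"
        using x p by (auto simp: dist_real_def intro!: bexI[of _ x])
    qed
    then show ?thesis using cover edge_in_sets by (rule_tac null_sets_subset) (simp_all add: sets_\<mu>)
  qed
  then have "(\<Union>e\<in>edges N. {p \<in> locations N. fst p = e}) \<in> null_sets \<mu>"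
    using finite_edges by (intro null_sets.finite_UN) auto
  also have "(\<Union>e\<in>edges N. {p \<in> locations N. fst p = e}) = space \<mu>"
    by (auto simp: space_\<mu> mem_locations)
  finally show False using M1.emeasure_space_1 by auto
qed

lemma expected_Z_CF_sqrt_lower:
  assumes "\<not> (\<exists>p\<in>locations N. measure \<mu> (net_point N p) = 1)"
  shows "\<exists>c>0. \<forall>n. c * sqrt (real n) \<le> expected_Z_CF N \<mu> \<nu> n"
proof -
  obtain q where q: "q \<in> locations N" "\<And>r. 0 < r \<Longrightarrow> 0 < measure \<mu> {p \<in> locations N. net_dist N p q < r}"
    using support_point by blast
  define f where "f p = net_dist N p q" for p
  have lip: "net_lipschitz 1 f" unfolding f_def by (rule net_lipschitz_net_dist[OF q(1)])
  have fM: "f \<in> borel_measurable (location_algebra N)" by (rule measurable_net_lipschitz[OF lip])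
  have f\<mu> [measurable]: "f \<in> borel_measurable \<mu>" and f\<nu>: "f \<in> borel_measurable \<nu>"
    using fM by (simp_all cong: measurable_cong_sets add: sets_\<mu> sets_\<nu>)
  obtain D where D: "\<And>p q. p \<in> locations N \<Longrightarrow> q \<in> locations N \<Longrightarrow> net_dist N p q \<le> D"
    using net_dist_bounded by blast
  have fb: "\<bar>f p\<bar> \<le> D" if "p \<in> locations N" for p
    using D[OF that q(1)] net_dist_nonneg[OF that q(1)] by (simp add: f_def)
  \<comment> \<open>A constant value \<open>m > 0\<close> contradicts the positive mass of the ball
    of radius \<open>m\<close> around \<open>q\<close>. If \<open>m\<close> is not positive,
    nonnegativity of distances puts all mass on the network point of \<open>q\<close>, which the
    hypothesis excludes.\<close>
  have nonconst: "\<not> (AE p in \<mu>. f p = m)" for m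
  proof
    assume m: "AE p in \<mu>. f p = m"
    have ball: "{p \<in> space \<mu>. f p < r} = {p \<in> locations N. net_dist N p q < r}" for r
      by (simp add: space_\<mu> f_def)
    have m_nonpos: "\<not> 0 < m"
    proof
      assume "0 < m"
      have "AE p in \<mu>. p \<notin> {p \<in> space \<mu>. f p < m}" using m by eventually_elim simp
      then have "measure \<mu> {p \<in> space \<mu>. f p < m} = 0" by (subst M1.prob_eq_0) auto
      then show False using q(2)[OF \<open>0 < m\<close>] by (simp add: ball)
    qed
    have "AE p in \<mu>. p \<in> net_point N q"
      using m AE_space
    proof eventually_elim
      case (elim p)
      then show ?case using net_dist_nonneg[of p q] q(1) m_nonpos by (simp add: mem_net_point space_\<mu> f_def)
    qed
    then have "measure \<mu> (net_point N q) = 1"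
      using net_point_in_sets[OF q(1)] by (subst (asm) M1.AE_in_set_eq_1) (simp_all add: sets_\<mu>)
    then show False using assms q(1) by blast
  qed
  have "\<exists>c>0. \<forall>n k. c * sqrt (real n) \<le> (\<integral>u. \<bar>(\<Sum>i<n. f (u i)) - k\<bar> \<partial>(\<Pi>\<^sub>M i\<in>{..<n}. \<mu>))"
    by (rule M1.sum_anticoncentration[where B = D, OF f\<mu> _ nonconst]) (simp add: fb space_\<mu>)
  then obtain c where c: "0 < c"
    "\<forall>n k. c * sqrt (real n) \<le> (\<integral>u. \<bar>(\<Sum>i<n. f (u i)) - k\<bar> \<partial>(\<Pi>\<^sub>M i\<in>{..<n}. \<mu>))"
    by blast
  have "c * sqrt (real n) \<le> expected_Z_CF N \<mu> \<nu> n" for n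
  proof -
    interpret S: prob_space "samples n" by (rule prob_space_samples)
    interpret V: prob_space "\<Pi>\<^sub>M i\<in>{..<n}. \<nu>" by (intro prob_space_PiM M2.prob_space_axioms)
    interpret U: prob_space "\<Pi>\<^sub>M i\<in>{..<n}. \<mu>" by (intro prob_space_PiM M1.prob_space_axioms)
    interpret UV: pair_sigma_finite "\<Pi>\<^sub>M i\<in>{..<n}. \<mu>" "\<Pi>\<^sub>M i\<in>{..<n}. \<nu>" ..
    interpret VU: pair_sigma_finite "\<Pi>\<^sub>M i\<in>{..<n}. \<nu>" "\<Pi>\<^sub>M i\<in>{..<n}. \<mu>" ..
    define W where "W u v = \<bar>(\<Sum>i<n. f (u i)) - (\<Sum>i<n. f (v i))\<bar>" for u v :: "nat \<Rightarrow> 'e \<times> real"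
    note e = expectation_lipschitz[OF lip, where n = n]
    have W_int: "integrable (samples n) (\<lambda>\<omega>. W (fst \<omega>) (snd \<omega>))"
      unfolding W_def using e(1,3)
      by (intro integrable_abs Bochner_Integration.integrable_diff Bochner_Integration.integrable_sum) auto
    then have W_int': "integrable (samples n) (case_prod W)" by (simp add: case_prod_unfold)
    have "c * sqrt (real n) = (\<integral>v. c * sqrt (real n) \<partial>(\<Pi>\<^sub>M i\<in>{..<n}. \<nu>))"
      by (simp add: V.prob_space)
    \<comment> \<open>For fixed \<open>v\<close> the inner integral is the mean deviation of the
      supply sum from the number \<open>k = (\<Sum>i<n. f (v i))\<close>; the bound does not depend
      on \<open>k\<close>.\<close>
    also have "\<dots> \<le> (\<integral>v. (\<integral>u. W u v \<partial>(\<Pi>\<^sub>M i\<in>{..<n}. \<mu>)) \<partial>(\<Pi>\<^sub>M i\<in>{..<n}. \<nu>))"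
      unfolding W_def
      by (rule integral_mono[OF _ UV.integrable_snd[OF W_int', unfolded W_def]]) (use c(2) in auto)
    also have "\<dots> = (\<integral>\<omega>. W (fst \<omega>) (snd \<omega>) \<partial>samples n)"
      by (subst UV.integral_snd[OF W_int']) (simp add: case_prod_unfold)
    also have "\<dots> \<le> (\<integral>\<omega>. min_matching_dist N n (fst \<omega>) (snd \<omega>) \<partial>samples n)"
    proof (rule integral_mono[OF W_int integrable_min_matching])
      fix \<omega> assume \<omega>: "\<omega> \<in> space (samples n)"
      have "(\<Sum>i<n. f (fst \<omega> i)) - (\<Sum>i<n. f (snd \<omega> i)) \<le> 1 * min_matching_dist N n (fst \<omega>) (snd \<omega>)"
        by (rule lipschitz_le_min_matching[OF lip]) (use sample_in_locations[OF \<omega>] in auto)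
      moreover have "(\<Sum>i<n. - f (fst \<omega> i)) - (\<Sum>i<n. - f (snd \<omega> i)) \<le> 1 * min_matching_dist N n (fst \<omega>) (snd \<omega>)"
        by (rule lipschitz_le_min_matching[OF net_lipschitz_uminus[OF lip]])
          (use sample_in_locations[OF \<omega>] in auto)
      ultimately show "W (fst \<omega>) (snd \<omega>) \<le> min_matching_dist N n (fst \<omega>) (snd \<omega>)"
        unfolding W_def by (simp add: sum_negf)
    qed
    finally show ?thesis by (simp add: expected_Z_CF_eq)
  qed
  with c(1) show ?thesis by blast
qed

lemma expected_Z_CF_bigthetaI:
  assumes "\<exists>C. \<forall>n. expected_Z_CF N \<mu> \<nu> n \<le> C * g n"
    and "\<exists>c>0. \<forall>n. c * g n \<le> expected_Z_CF N \<mu> \<nu> n" and g: "\<And>n. 0 \<le> g n"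
  shows "expected_Z_CF N \<mu> \<nu> \<in> \<Theta>(g)"
proof -
  obtain C c where C: "\<And>n. expected_Z_CF N \<mu> \<nu> n \<le> C * g n"
    and c: "0 < c" "\<And>n. c * g n \<le> expected_Z_CF N \<mu> \<nu> n" using assms by blast
  show ?thesis
  proof (rule bigthetaI)
    show "expected_Z_CF N \<mu> \<nu> \<in> O(g)"
      by (rule bigoI[of _ C]) (use C g expected_Z_CF_nonneg in simp)
    show "expected_Z_CF N \<mu> \<nu> \<in> \<Omega>(g)"
      by (rule landau_omega.bigI[OF c(1)]) (use c(2) g expected_Z_CF_nonneg in simp)
  qed
qed

end

theorem mainTheorem5:
  fixes N :: "('v, 'e) network"
    and \<mu> \<nu> :: "('e \<times> real) measure"
  assumes "connected_network N"
    and "prob_space \<mu>" and "sets \<mu> = sets (location_algebra N)"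
    and "prob_space \<nu>" and "sets \<nu> = sets (location_algebra N)"
  shows "(\<forall>n u v. (\<forall>i<n. u i \<in> locations N \<and> v i \<in> locations N) \<longrightarrow>
            Z_CF N n u v = min_matching_dist N n u v) \<and>
         (same_distribution N \<mu> \<nu> \<and> \<not> (\<exists>p\<in>locations N. measure \<mu> (net_point N p) = 1) \<longrightarrow>
            expected_Z_CF N \<mu> \<nu> \<in> \<Theta>(\<lambda>n. sqrt (real n))) \<and>
         (\<not> same_distribution N \<mu> \<nu> \<longrightarrow>
            expected_Z_CF N \<mu> \<nu> \<in> \<Theta>(\<lambda>n. real n))"
proof -
  interpret M1: prob_space \<mu> by fact
  interpret M2: prob_space \<nu> by fact
  interpret random_network N \<mu> \<nu> by unfold_locales (fact assms)+
  show ?thesis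
  proof (intro conjI impI allI)
    fix n :: nat and u v :: "nat \<Rightarrow> 'e \<times> real"
    assume "\<forall>i<n. u i \<in> locations N \<and> v i \<in> locations N"
    then show "Z_CF N n u v = min_matching_dist N n u v"
      by (intro Z_CF_eq_min_matching_dist) auto
  next
    assume "same_distribution N \<mu> \<nu> \<and> \<not> (\<exists>p\<in>locations N. measure \<mu> (net_point N p) = 1)"
    then show "expected_Z_CF N \<mu> \<nu> \<in> \<Theta>(\<lambda>n. sqrt (real n))"
      by (intro expected_Z_CF_bigthetaI expected_Z_CF_sqrt_upper expected_Z_CF_sqrt_lower) auto
  next
    assume "\<not> same_distribution N \<mu> \<nu>"
    then show "expected_Z_CF N \<mu> \<nu> \<in> \<Theta>(\<lambda>n. real n)"
      by (intro expected_Z_CF_bigthetaI expected_Z_CF_linear_upper expected_Z_CF_linear_lower) auto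
  qed
qed

end
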